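(* Let $f$ and $A_0$ be as in the context and, for $\rho>0$, let $\mathcal S(\varphi,\psi)=(\varphi+\rho f(\varphi,\psi),A_0\psi)$. There exist $\rho_*>0$ and a constant $C_5$, independent of $\rho$, such that for all $\rho\in(0,\rho_* )$ the function $W=W_\rho:\mathbb T^2\to\mathbb R$ whose graph is the invariant manifold of $\mathcal S$ satisfies $$|\langle W\rangle|\le C_5\,\rho,\qquad \langle W^2\rangle\le C_5\,\rho .$$
   Context: $\mathbb T=\mathbb R/2\pi\mathbb Z$. $A_0$ is an Anosov (hyperbolic linear) automorphism of $\mathbb T^2$. $\langle g\rangle=\int_{\mathbb T^2}g(\psi)\,d\psi/(2\pi)^2$. For $\alpha\in(0,1]$, $k\ge1$, and $g(\varphi,\psi)$ on $\mathbb T\times\mathbb T^2$: $|g|_\alpha=\sup|g(\varphi,\psi')-g(\varphi,\psi)|/|\psi'-\psi|^\alpha$, and $\mathscr B_{\alpha,k}$ is the space of functions $k$ times continuously differentiable in $\varphi$ with $|||g|||_{\alpha,k}=\sum_{n=0}^k\|\partial_\varphi^ng\|_\infty+\alpha\sum_{n=0}^{k-1}|\partial_\varphi^ng|_\alpha<\infty$. Standing assumptions: $f\in\mathscr B_{\alpha_0,6}(\mathbb T\times\mathbb T^2,\mathbb R)$ for some $\alpha_0\in(0,1]$, $|||f|||_{\alpha_0,6}=1$; there is a closed interval $\mathcal U=[\phi_m,\phi_M]\subsetneq\mathbb T$, $\phi_m<\phi_M$ (identified with an interval of $\mathbb R$), with $\Omega=\mathcal U\times\mathbb T^2$, such that $f(\phi_m,\psi)>0>f(\phi_M,\psi)$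 for all $\psi$; for every $\psi$ there is a unique $S(\psi)\in\operatorname{int}\mathcal U$ with $f(S(\psi),\psi)=0$; with $S_m=\inf_\psi S$, $S_M=\sup_\psi S$, $\Lambda=[S_m,S_M]\times\mathbb T^2$, one has $\gamma:=-\sup_{\Lambda}\partial_\varphi f>0$. The parametrization of $\mathbb T$ is such that $0\in[S_m,S_M]$ is the unique zero in $\mathcal U$ of $\varphi\mapsto\langle f(\varphi,\cdot)\rangle$. The parameter $\rho$ is taken smaller than a suitable $\rho_*>0$ depending on $f$, such that in particular $1+\rho\,\partial_\varphi f>0$ on $\Omega$ for all $\rho\in(0,\rho_* )$. Then $\mathcal S(\Omega)\subset\Omega$, and there is a unique $W:\mathbb T^2\to\mathbb R$ with graph in $\Lambda$ such that $\mathcal S(W(\psi),\psi)=(W(A_0\psi),A_0\psi)$ for all $\psi$ (the graph is the invariant manifold); $W$ is Hölder continuous. *)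

theory Defs
  imports "HOL-Analysis.Analysis"
begin

text \<open>
  Functions on the torus \<open>(\<real> / 2\<pi>\<int>)\<^sup>2\<close> are represented by their lifts to \<open>\<real>\<^sup>2\<close>, i.e. by
  functions that are \<open>2\<pi>\<close>-periodic in each coordinate; likewise for functions on \<open>\<real> / 2\<pi>\<int>\<close>.
\<close>

definition periodic_T :: "(real \<Rightarrow> 'b) \<Rightarrow> bool" where
  "periodic_T h \<longleftrightarrow> (\<forall>\<phi>. h (\<phi> + 2 * pi) = h \<phi>)"

definition periodic_T2 :: "(real^2 \<Rightarrow> 'b) \<Rightarrow> bool" where
  "periodic_T2 h \<longleftrightarrow> (\<forall>\<psi> i. h (\<psi> + axis i (2 * pi)) = h \<psi>)"

text \<open>The average over the torus, computed on the fundamental domain \<open>[0, 2\<pi>]\<^sup>2\<close>.\<close>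

definition torus_avg :: "(real^2 \<Rightarrow> real) \<Rightarrow> real" where
  "torus_avg h = (LINT \<psi>:cbox 0 (vec (2 * pi))|lborel. h \<psi>) / (2 * pi)\<^sup>2"

definition anosov_automorphism :: "real^2^2 \<Rightarrow> bool" where
  "anosov_automorphism A \<longleftrightarrow>
     (\<forall>i j. A $ i $ j \<in> \<int>) \<and> \<bar>det A\<bar> = 1 \<and>
     (\<forall>(l::complex) (v::complex^2).
        v \<noteq> 0 \<and> (\<chi> i j. complex_of_real (A $ i $ j)) *v v = l *s v \<longrightarrow> cmod l \<noteq> 1)"

definition dphi :: "nat \<Rightarrow> (real \<Rightarrow> real^2 \<Rightarrow> real) \<Rightarrow> real \<Rightarrow> real^2 \<Rightarrow> real" where
  "dphi n g \<phi> \<psi> = (deriv ^^ n) (\<lambda>x. g x \<psi>) \<phi>"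

text \<open>The (semi)norms below take values in \<open>[0, \<infinity>]\<close>, so that unbounded suprema equal \<open>\<infinity>\<close>.\<close>

definition sup_norm :: "(real \<Rightarrow> real^2 \<Rightarrow> real) \<Rightarrow> ennreal" where
  "sup_norm g = (SUP (\<phi>, \<psi>). ennreal \<bar>g \<phi> \<psi>\<bar>)"

text \<open>
  The distance on the torus is the minimum of the Euclidean distances between lifts, so for
  periodic \<open>g\<close> the supremum over all pairs of lifts is the supremum over pairs of torus points.
  Pairs with \<open>\<psi>' = \<psi>\<close> contribute \<open>0 / 0 = 0\<close>.
\<close>

definition holder_seminorm :: "real \<Rightarrow> (real \<Rightarrow> real^2 \<Rightarrow> real) \<Rightarrow> ennreal" where
  "holder_seminorm \<alpha> g =
     (SUP (\<phi>, \<psi>, \<psi>'). ennreal (\<bar>g \<phi> \<psi>' - g \<phi> \<psi>\<bar> / norm (\<psi>' - \<psi>) powr \<alpha>))"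

definition B_norm :: "real \<Rightarrow> nat \<Rightarrow> (real \<Rightarrow> real^2 \<Rightarrow> real) \<Rightarrow> ennreal" where
  "B_norm \<alpha> k g =
     (\<Sum>n\<le>k. sup_norm (dphi n g)) + ennreal \<alpha> * (\<Sum>n<k. holder_seminorm \<alpha> (dphi n g))"

definition B_space :: "real \<Rightarrow> nat \<Rightarrow> (real \<Rightarrow> real^2 \<Rightarrow> real) set" where
  "B_space \<alpha> k = {g.
     (\<forall>\<psi>. periodic_T (\<lambda>\<phi>. g \<phi> \<psi>)) \<and> (\<forall>\<phi>. periodic_T2 (g \<phi>)) \<and>
     (\<forall>\<psi>. (\<forall>n<k. \<forall>\<phi>. (\<lambda>x. dphi n g x \<psi>) differentiable (at \<phi>)) \<and>
          continuous_on UNIV (\<lambda>x. dphi k g x \<psi>)) \<and>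
     B_norm \<alpha> k g < \<infinity>}"

definition skew_map ::
  "(real \<Rightarrow> real^2 \<Rightarrow> real) \<Rightarrow> real^2^2 \<Rightarrow> real \<Rightarrow> real \<times> (real^2) \<Rightarrow> real \<times> (real^2)" where
  "skew_map f A \<rho> = (\<lambda>(\<phi>, \<psi>). (\<phi> + \<rho> * f \<phi> \<psi>, A *v \<psi>))"

definition invariant_graph ::
  "(real \<Rightarrow> real^2 \<Rightarrow> real) \<Rightarrow> real^2^2 \<Rightarrow> real \<Rightarrow> (real \<times> (real^2)) set \<Rightarrow> (real^2 \<Rightarrow> real) \<Rightarrow> bool" where
  "invariant_graph f A \<rho> \<Lambda> W \<longleftrightarrow>
     periodic_T2 W \<and> (\<forall>\<psi>. (W \<psi>, \<psi>) \<in> \<Lambda>) \<and>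
     (\<forall>\<psi>. skew_map f A \<rho> (W \<psi>, \<psi>) = (W (A *v \<psi>), A *v \<psi>))"

end

(*
  The invariant function satisfies W(A psi) = W(psi) + rho f(W(psi), psi).  Since the mean is
  invariant under A, averaging this identity and its square gives <f(W, .)> = 0 and
  2 <W f(W, .)> = - rho <f(W, .)^2>.  If f could be replaced here by its mean over psi for frozen phi,
  which vanishes at phi = 0 and decreases at rate at least gamma, both estimates would follow.
  The error is <g(W(psi), psi)> with g(phi, .) of mean zero, and is O(rho): W is built from the past
  of psi and hence is Hoelder continuous along the expanding direction with a constant O(rho) (it has
  no useful regularity along the contracting one), and for such functions correlations with
  zero-mean Hoelder observables at time n decay exponentially.  Summing the differences of
  <g(W(psi), A^n psi)> over n gives the bound.

  Decay of correlations is proved without Fourier series: averages over large parallelograms are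
  close to the mean, and A turns a thin long parallelogram into one that is large in both directions.
*)
theory Submission
  imports Defs
begin

section \<open>Averages over the torus\<close>

text \<open>The obstacle is that the fibre maps contract only at the rate
  \<open>1 - \<rho> * \<gamma>\<close>, which tends to 1 as \<rho> tends to 0. Summing errors of
  size \<rho> against that rate gives O(1), not O(\<rho>). The missing smallness comes from the
  base: under backward iteration displacements along \<open>eu\<close> shrink by the factor
  \<bar>\<mu>\<bar> per step, uniformly in \<rho>, whereas displacements along \<open>es\<close>
  grow, which is why regularity of W along \<open>es\<close> is never asked for. For the telescoped
  correlations to add up to O(\<rho>), the increment of g between W and its composition with A must
  carry the factor \<rho> in every norm of the correlation bound, including the Hoelder seminorm in
  the second variable. This is where Hoelder continuity of the \<phi>-derivative of f enters, as a
  bound on mixed second differences. The second moment comes before the first: it is controlled by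
  the observable \<phi> * (f - <f>), and it then dominates the quadratic remainder when <f(\<phi>,
  .)> is linearized at 0 to isolate <W>.\<close>

abbreviation cell :: "(real^2) set" where
  "cell \<equiv> cbox 0 (vec (2 * pi))"

lemma cell_iff: "x \<in> cell \<longleftrightarrow> (\<forall>i. 0 \<le> x $ i \<and> x $ i \<le> 2 * pi)"
  by (simp add: mem_box_cart)

lemma cell_nonempty: "cell \<noteq> {}"
  by (simp add: interval_ne_empty_cart)

lemma content_cell: "measure lborel cell = (2 * pi)\<^sup>2"
  using content_cbox_cart[OF cell_nonempty] by (simp add: power2_eq_square prod.distrib UNIV_2)

lemma set_integrable_cell:
  assumes "continuous_on UNIV h"
  shows "set_integrable lborel cell (h :: real^2 \<Rightarrow> real)"
  unfolding set_integrable_def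
  by (rule borel_integrable_compact) (auto intro: continuous_on_subset[OF assms])

lemma torus_avg_eq_integral:
  assumes "continuous_on UNIV h"
  shows "torus_avg h = integral cell h / (2 * pi)\<^sup>2"
  unfolding torus_avg_def
  by (subst set_borel_integral_eq_integral(2)) (auto intro: set_integrable_cell assms)

lemma torus_avg_const [simp]: "torus_avg (\<lambda>_. c) = c"
  by (subst torus_avg_eq_integral) (auto simp: content_cell)

lemma torus_avg_add:
  assumes "continuous_on UNIV g" "continuous_on UNIV h"
  shows "torus_avg (\<lambda>x. g x + h x) = torus_avg g + torus_avg h"
  using assms set_integral_add(2)[OF set_integrable_cell set_integrable_cell, of g h]
  by (simp add: torus_avg_def add_divide_distrib)

lemma torus_avg_diff:
  assumes "continuous_on UNIV g" "continuous_on UNIV h"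
  shows "torus_avg (\<lambda>x. g x - h x) = torus_avg g - torus_avg h"
  using assms set_integral_diff(2)[OF set_integrable_cell set_integrable_cell, of g h]
  by (simp add: torus_avg_def diff_divide_distrib)

lemma torus_avg_cmult: "torus_avg (\<lambda>x. c * h x) = c * torus_avg h"
  by (simp add: torus_avg_def)

lemma torus_avg_mono:
  assumes "continuous_on UNIV g" "continuous_on UNIV h" "\<And>x. x \<in> cell \<Longrightarrow> g x \<le> h x"
  shows "torus_avg g \<le> torus_avg h"
  unfolding torus_avg_def
  by (intro divide_right_mono set_integral_mono set_integrable_cell assms) auto

lemma torus_avg_dist_le:
  assumes "continuous_on UNIV h" "\<And>x. x \<in> cell \<Longrightarrow> \<bar>h x - c\<bar> \<le> e"
  shows "\<bar>torus_avg h - c\<bar> \<le> e"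
proof -
  have "torus_avg h \<le> torus_avg (\<lambda>_. c + e)" "torus_avg (\<lambda>_. c - e) \<le> torus_avg h"
    using assms(2) by (auto intro!: torus_avg_mono assms(1) simp del: torus_avg_const simp: abs_diff_le_iff algebra_simps)
  then show ?thesis by auto
qed

lemma torus_avg_abs_le:
  assumes "continuous_on UNIV h" "\<And>x. \<bar>h x\<bar> \<le> e"
  shows "\<bar>torus_avg h\<bar> \<le> e"
  using torus_avg_dist_le[of h 0 e] assms by simp

lemma continuous_on_slice:
  assumes "continuous_on UNIV (\<lambda>(x, y). h x y)"
  shows "continuous_on UNIV (h x)" "continuous_on UNIV (\<lambda>x. h x y)"
  using continuous_on_compose2[OF assms, of UNIV "\<lambda>y. (x, y)"]
    continuous_on_compose2[OF assms, of UNIV "\<lambda>x. (x, y)"]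
  by (simp_all add: continuous_on_Pair)

lemma continuous_on_torus_avg:
  fixes h :: "'a::topological_space \<Rightarrow> real^2 \<Rightarrow> real"
  assumes "continuous_on UNIV (\<lambda>(x, y). h x y)"
  shows "continuous_on UNIV (\<lambda>x. torus_avg (h x))"
proof -
  have "continuous_on UNIV (\<lambda>x. integral cell (h x) / (2 * pi)\<^sup>2)"
    by (intro continuous_intros integral_continuous_on_param continuous_on_subset[OF assms]) auto
  moreover have "continuous_on UNIV (h x)" for x
    using continuous_on_compose2[OF assms, of UNIV "\<lambda>y. (x, y)"] by (simp add: continuous_on_Pair)
  ultimately show ?thesis
    by (simp add: torus_avg_eq_integral)
qed

lemma torus_avg_swap:
  assumes "continuous_on UNIV (\<lambda>(x, y). h x y)"
  shows "torus_avg (\<lambda>x. torus_avg (h x)) = torus_avg (\<lambda>y. torus_avg (\<lambda>x. h x y))"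
proof -
  have c: "continuous_on UNIV (\<lambda>(y, x). h x y)"
    using continuous_on_compose2[OF assms, of UNIV "\<lambda>(y, x). (x, y)"]
    by (simp add: continuous_on_Pair continuous_on_fst continuous_on_snd case_prod_beta)
  have "integral cell (\<lambda>x. integral cell (h x)) = integral cell (\<lambda>y. integral cell (\<lambda>x. h x y))"
    by (rule integral_swap_continuous[OF continuous_on_subset[OF assms]]) simp
  then show ?thesis
    using continuous_on_torus_avg[OF assms] continuous_on_torus_avg[OF c]
    by (simp add: torus_avg_eq_integral continuous_on_slice[OF assms])
qed

text \<open>The shifted cell differs from the cell by boundary strips of total area at most 4 * pi *
  (|q1| + |q2|), and 4 * pi is at most (2 * pi)^2. No periodicity appears since h will be a periodic
  function composed with the affine parametrization of a parallelogram, which is not periodic in its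
  parameters.\<close>

lemma torus_avg_shift_diff:
  fixes q :: "real^2"
  assumes h: "continuous_on UNIV h" and H: "\<And>x. \<bar>h x\<bar> \<le> H"
  shows "\<bar>torus_avg (\<lambda>x. h (x + q)) - torus_avg h\<bar> \<le> H * (\<bar>q $ 1\<bar> + \<bar>q $ 2\<bar>)"
proof -
  have H0: "0 \<le> H" using H[of 0] by simp
  define C' :: "(real^2) set" where "C' = cbox (0 + q) (vec (2 * pi) + q)"
  define I :: "(real^2) set" where "I = cell \<inter> C'"
  have meas: "measure lborel C' = (2 * pi)\<^sup>2"
    unfolding C'_def by (subst content_cbox_cart) (auto simp: interval_ne_empty_cart UNIV_2 power2_eq_square)
  have Ieq: "I = cbox (\<chi> i. max 0 (q $ i)) (\<chi> i. min (2 * pi) (2 * pi + q $ i))"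
    unfolding I_def C'_def by (subst Int_interval_cart) (simp add: interval_cbox)
  have "(2 * pi)\<^sup>2 - 2 * pi * (\<bar>q $ 1\<bar> + \<bar>q $ 2\<bar>) \<le> measure lborel I"
  proof (cases "\<bar>q $ 1\<bar> \<le> 2 * pi \<and> \<bar>q $ 2\<bar> \<le> 2 * pi")
    case True
    have "measure lborel I = (2 * pi - \<bar>q $ 1\<bar>) * (2 * pi - \<bar>q $ 2\<bar>)"
      unfolding Ieq using True
      by (subst content_cbox_cart) (auto simp: interval_ne_empty_cart UNIV_2 forall_2 exhaust_2
          max_def min_def abs_if algebra_simps dest!: not_less_iff_gr_or_eq[THEN iffD1] split: if_splits)
    also have "\<dots> = (2 * pi)\<^sup>2 - 2 * pi * (\<bar>q $ 1\<bar> + \<bar>q $ 2\<bar>) + \<bar>q $ 1\<bar> * \<bar>q $ 2\<bar>"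
      by (simp add: power2_eq_square algebra_simps)
    finally show ?thesis by simp
  next
    case False
    \<comment> \<open>A shift longer than a side makes the claimed lower bound nonpositive.\<close>
    then have "2 * pi * (2 * pi) \<le> 2 * pi * (\<bar>q $ 1\<bar> + \<bar>q $ 2\<bar>)"
      by (intro mult_left_mono) auto
    then show ?thesis by (simp add: power2_eq_square order_trans[OF _ measure_nonneg])
  qed
  moreover have "(2 * pi) ^ 2 * \<bar>torus_avg (\<lambda>x. h (x + q)) - torus_avg h\<bar>
      \<le> H * (2 * (2 * pi)\<^sup>2 - 2 * measure lborel I)"
  proof -
    have i1: "set_integrable lborel cell h" by (rule set_integrable_cell[OF h])
    have i2: "set_integrable lborel C' h"
      unfolding set_integrable_def C'_def
      by (rule borel_integrable_compact) (auto intro: continuous_on_subset[OF h])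
    have "torus_avg (\<lambda>x. h (x + q)) = integral cell (\<lambda>x. h (x + q)) / (2 * pi)\<^sup>2"
      by (intro torus_avg_eq_integral continuous_on_compose2[OF h]) (auto intro!: continuous_intros)
    also have "integral cell (\<lambda>x. h (x + q)) = integral C' h"
      using integral_shift_cbox[of "0 + q" q "vec (2 * pi) + q" h] by (simp add: C'_def)
    also have "\<dots> = (LINT x:C'|lborel. h x)"
      by (rule set_borel_integral_eq_integral(2)[OF i2, symmetric])
    finally have "(2 * pi) ^ 2 * (torus_avg (\<lambda>x. h (x + q)) - torus_avg h)
        = (LINT x:C'|lborel. h x) - (LINT x:cell|lborel. h x)"
      by (simp add: torus_avg_def divide_simps)
    also have "\<dots> = (LINT x|lborel. (indicator C' x - indicator cell x) * h x)"
      using i1 i2 unfolding set_lebesgue_integral_def set_integrable_def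
      by (simp flip: Bochner_Integration.integral_diff add: left_diff_distrib)
    finally have "\<bar>(2 * pi) ^ 2 * (torus_avg (\<lambda>x. h (x + q)) - torus_avg h)\<bar> =
        norm (LINT x|lborel. (indicator C' x - indicator cell x) * h x)" by simp
    \<comment> \<open>The weight on the right is the indicator of the symmetric difference of the
      two cells.\<close>
    also have "\<dots> \<le> (LINT x|lborel. H * (indicator C' x + indicator cell x - 2 * indicator I x))"
    proof (rule order_trans[OF Bochner_Integration.integral_norm_bound integral_mono])
      show "integrable lborel (\<lambda>x. norm ((indicator C' x - indicator cell x) * h x))"
        using Bochner_Integration.integrable_norm[OF Bochner_Integration.integrable_diff[OF i2[unfolded set_integrable_def]
          i1[unfolded set_integrable_def]]]
        by (simp add: left_diff_distrib)
      show "integrable lborel (\<lambda>x. H * (indicator C' x + indicator cell x - 2 * indicator I x))"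
        unfolding C'_def Ieq
        by (intro integrable_mult_right Bochner_Integration.integrable_diff
            Bochner_Integration.integrable_add integrable_real_indicator)
           (auto simp: emeasure_lborel_cbox_finite[unfolded infinity_ennreal_def])
      fix x
      show "norm ((indicator C' x - indicator cell x) * h x)
          \<le> H * (indicator C' x + indicator cell x - 2 * indicator I x)"
        using H[of x] by (auto simp: I_def indicator_def)
    qed
    also have "\<dots> = H * (measure lborel C' + measure lborel cell - 2 * measure lborel I)"
    proof -
      have "integrable lborel (indicat_real C')" "integrable lborel (indicat_real cell)"
        "integrable lborel (indicat_real I)"
        unfolding C'_def Ieq
        by (auto intro!: integrable_real_indicator simp: emeasure_lborel_cbox_finite[unfolded infinity_ennreal_def])
      then show ?thesis by (simp add: Ieq C'_def)
    qed
    finally show ?thesis by (simp add: meas content_cell abs_mult)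
  qed
  ultimately have "(2 * pi) ^ 2 * \<bar>torus_avg (\<lambda>x. h (x + q)) - torus_avg h\<bar>
      \<le> H * (2 * (2 * pi * (\<bar>q $ 1\<bar> + \<bar>q $ 2\<bar>)))"
    using mult_left_mono[OF _ H0, of "2 * (2 * pi)\<^sup>2 - 2 * measure lborel I" "2 * (2 * pi * (\<bar>q $ 1\<bar> + \<bar>q $ 2\<bar>))"]
    by linarith
  also have "\<dots> = (4 * pi) * (H * (\<bar>q $ 1\<bar> + \<bar>q $ 2\<bar>))" by simp
  also have "\<dots> \<le> (2 * pi)\<^sup>2 * (H * (\<bar>q $ 1\<bar> + \<bar>q $ 2\<bar>))"
    using pi_ge_two H0 by (intro mult_right_mono) (auto simp: power2_eq_square)
  finally show ?thesis by simp
qed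

section \<open>Invariance of the average under toral automorphisms\<close>

definition lattice_vec :: "int^2 \<Rightarrow> real^2" where
  "lattice_vec k = (\<chi> i. 2 * pi * of_int (k $ i))"

text \<open>Half-open, so that its lattice translates partition the plane exactly; closed cells
  overlap on their edges.\<close>

definition half_cell :: "(real^2) set" where
  "half_cell = {x. \<forall>i. 0 \<le> x $ i \<and> x $ i < 2 * pi}"

lemma half_cell_measurable [measurable]: "half_cell \<in> sets borel"
  unfolding half_cell_def forall_2 by measurable

lemma periodic_T2_lattice:
  assumes "periodic_T2 h"
  shows "h (x + lattice_vec k) = h x"
proof -
  have n: "h (x + axis i (2 * pi * real n)) = h x" for x i n
  proof (induction n)
    case (Suc n)
    have "x + axis i (2 * pi * real (Suc n)) = (x + axis i (2 * pi * real n)) + axis i (2 * pi)"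
      by (simp add: vec_eq_iff axis_def algebra_simps)
    then show ?case using assms Suc unfolding periodic_T2_def by metis
  next
    case 0
    have "axis i (2 * pi * real 0) = (0 :: real^2)" by (simp add: vec_eq_iff axis_def)
    then show ?case by (simp only: add_0_right)
  qed
  have z: "h (x + axis i (2 * pi * of_int m)) = h x" for x i m
  proof (cases "m \<ge> 0")
    case True
    then show ?thesis using n[of x i "nat m"] by simp
  next
    case False
    then have "(x + axis i (2 * pi * of_int m)) + axis i (2 * pi * real (nat (- m))) = x"
      by (simp add: vec_eq_iff axis_def algebra_simps)
    then show ?thesis using n[of "x + axis i (2 * pi * of_int m)" i "nat (- m)"] by metis
  qed
  have "x + lattice_vec k = (x + axis 1 (2 * pi * of_int (k $ 1))) + axis 2 (2 * pi * of_int (k $ 2))"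
    by (simp add: vec_eq_iff lattice_vec_def axis_def forall_2)
  then show ?thesis by (simp only: z)
qed

lemma half_cell_translate_ex1: "\<exists>!k. x + lattice_vec k \<in> half_cell"
proof
  have *: "0 \<le> t + 2 * pi * of_int m \<and> t + 2 * pi * of_int m < 2 * pi
    \<longleftrightarrow> m = - \<lfloor>t / (2 * pi)\<rfloor>" for t :: real and m :: int
  proof -
    have "\<lfloor>t / (2 * pi)\<rfloor> = - m \<longleftrightarrow> of_int (- m) \<le> t / (2 * pi) \<and> t / (2 * pi) < of_int (- m) + 1"
      by (rule floor_eq_iff)
    also have "\<dots> \<longleftrightarrow> 0 \<le> t + 2 * pi * of_int m \<and> t + 2 * pi * of_int m < 2 * pi"
      using pi_gt_zero by (simp add: field_simps) argo
    finally show ?thesis by linarith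
  qed
  show "x + lattice_vec (\<chi> i. - \<lfloor>x $ i / (2 * pi)\<rfloor>) \<in> half_cell"
    using *[of "x $ _" "- \<lfloor>x $ _ / (2 * pi)\<rfloor>"] by (simp add: half_cell_def lattice_vec_def)
  show "k = (\<chi> i. - \<lfloor>x $ i / (2 * pi)\<rfloor>)" if "x + lattice_vec k \<in> half_cell" for k
    using that *[of "x $ _" "k $ _"] by (simp add: half_cell_def lattice_vec_def vec_eq_iff)
qed

lemma nn_integral_one_translate:
  assumes "bij \<sigma>"
  shows "(\<integral>\<^sup>+k. indicator half_cell (x + lattice_vec (\<sigma> k)) \<partial>count_space UNIV) = 1"
proof -
  obtain k0 where k0: "\<And>k. x + lattice_vec k \<in> half_cell \<longleftrightarrow> k = k0"
    using half_cell_translate_ex1[of x] by metis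
  have "indicator half_cell (x + lattice_vec (\<sigma> k)) = (indicator {inv \<sigma> k0} k :: ennreal)" for k
    using k0[of "\<sigma> k"] assms by (auto simp: indicator_def bij_inv_eq_iff)
  then show ?thesis by simp
qed

lemma nn_integral_translate:
  fixes g :: "real^2 \<Rightarrow> ennreal"
  assumes [measurable]: "g \<in> borel_measurable borel"
  shows "(\<integral>\<^sup>+x. g (x + c) \<partial>lborel) = (\<integral>\<^sup>+x. g x \<partial>lborel)"
  by (subst (2) lborel_distr_plus[of c, symmetric]) (simp add: nn_integral_distr add.commute)

text \<open>Insert the partition of unity by translates of the half-open cell, exchange sum and
  integral, and translate each summand back. Working in \<open>ennreal\<close> makes the exchange
  unconditional.\<close>

lemma nn_integral_fold:
  assumes [measurable]: "g \<in> borel_measurable borel"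
  shows "(\<integral>\<^sup>+x. g x \<partial>lborel) =
    (\<integral>\<^sup>+x. (\<integral>\<^sup>+k. g (x + lattice_vec k) \<partial>count_space UNIV) * indicator half_cell x \<partial>lborel)"
proof -
  have bij: "bij (uminus :: int^2 \<Rightarrow> int^2)"
    by (rule involuntory_imp_bij) simp
  have neg: "lattice_vec (- k) = - lattice_vec k" for k
    by (simp add: lattice_vec_def vec_eq_iff)
  have "(\<integral>\<^sup>+x. g x \<partial>lborel) =
      (\<integral>\<^sup>+x. g x * (\<integral>\<^sup>+k. indicator half_cell (x + lattice_vec (- k)) \<partial>count_space UNIV) \<partial>lborel)"
    by (simp only: nn_integral_one_translate[OF bij] mult_1_right)
  also have "\<dots> = (\<integral>\<^sup>+x. (\<integral>\<^sup>+k. g x * indicator half_cell (x - lattice_vec k) \<partial>count_space UNIV) \<partial>lborel)"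
    by (simp add: nn_integral_cmult neg)
  also have "\<dots> = (\<integral>\<^sup>+k. (\<integral>\<^sup>+x. g x * indicator half_cell (x - lattice_vec k) \<partial>lborel) \<partial>count_space UNIV)"
    by (rule nn_integral_count_space_nn_integral) auto
  also have "\<dots> = (\<integral>\<^sup>+k. (\<integral>\<^sup>+x. g (x + lattice_vec k) * indicator half_cell x \<partial>lborel) \<partial>count_space UNIV)"
    using nn_integral_translate[of "\<lambda>x. g x * indicator half_cell (x - lattice_vec k)" "lattice_vec k" for k]
    by simp
  also have "\<dots> = (\<integral>\<^sup>+x. (\<integral>\<^sup>+k. g (x + lattice_vec k) * indicator half_cell x \<partial>count_space UNIV) \<partial>lborel)"
    by (rule nn_integral_count_space_nn_integral[symmetric]) auto
  also have "\<dots> = (\<integral>\<^sup>+x. (\<integral>\<^sup>+k. g (x + lattice_vec k) \<partial>count_space UNIV) * indicator half_cell x \<partial>lborel)"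
    by (simp add: nn_integral_multc)
  finally show ?thesis .
qed

text \<open>It suffices to measure boxes: the preimage of a box under A is its image under the
  inverse B, and linear images scale volume by the modulus of the determinant.\<close>

lemma lborel_distr_matrix:
  fixes A B :: "real^'n::{finite,wellorder}^'n::{finite,wellorder}"
  assumes AB: "A ** B = mat 1" and BA: "B ** A = mat 1" and det: "\<bar>det B\<bar> = 1"
  shows "distr lborel borel ((*v) A) = lborel"
proof (rule lborel_eqI[symmetric])
  have A_meas: "(*v) A \<in> borel_measurable borel"
    by (intro borel_measurable_continuous_onI matrix_vector_mult_linear_continuous_on)
  fix l u :: "real^'n::{finite,wellorder}" assume le: "\<And>b. b \<in> Basis \<Longrightarrow> l \<bullet> b \<le> u \<bullet> b"
  have vim: "(*v) A -` box l u = (*v) B ` box l u"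
  proof (intro set_eqI iffI)
    fix x assume "x \<in> (*v) A -` box l u"
    then show "x \<in> (*v) B ` box l u"
      by (intro image_eqI[of _ _ "A *v x"]) (auto simp: matrix_vector_mul_assoc BA)
  qed (auto simp: matrix_vector_mul_assoc AB)
  have "(*v) A -` box l u \<in> sets borel"
    using measurable_sets[OF A_meas, of "box l u"] by simp
  then have "emeasure (distr lborel borel ((*v) A)) (box l u) = emeasure lebesgue ((*v) B ` box l u)"
    using A_meas by (simp add: emeasure_distr vim)
  also have "\<dots> = ennreal (measure lebesgue ((*v) B ` box l u))"
    by (intro emeasure_eq_measure2 measurable_linear_image matrix_vector_mul_linear) simp
  also have "\<dots> = ennreal (measure lebesgue (box l u))"
    by (simp add: measure_linear_image[OF matrix_vector_mul_linear] det)
  also have "\<dots> = (\<Prod>b\<in>Basis. (u - l) \<bullet> b)"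
    using le by (simp add: measure_lborel_box_eq)
  finally show "emeasure (distr lborel borel ((*v) A)) (box l u) = (\<Prod>b\<in>Basis. (u - l) \<bullet> b)" .
qed simp

definition int_matrix :: "real^2^2 \<Rightarrow> bool" where
  "int_matrix A \<longleftrightarrow> (\<forall>i j. A $ i $ j \<in> \<int>)"

lemma int_matrix_lattice_vec:
  assumes "int_matrix A"
  shows "A *v lattice_vec k = lattice_vec (\<chi> i. \<Sum>j\<in>UNIV. \<lfloor>A $ i $ j\<rfloor> * k $ j)"
proof -
  have fl: "real_of_int \<lfloor>A $ i $ j\<rfloor> = A $ i $ j" for i j
    using assms by (metis int_matrix_def Ints_cases floor_of_int)
  show ?thesis
    by (simp add: fl vec_eq_iff matrix_vector_mult_def lattice_vec_def sum_distrib_left algebra_simps)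
qed

lemma inj_lattice_vec: "inj lattice_vec"
  by (rule injI) (simp add: lattice_vec_def vec_eq_iff)

text \<open>On the whole plane the change of variables is free and moves the affine map from h into
  the indicator of the cell. Folding back over the lattice leaves the periodic h unchanged, and the
  translated indicators still sum to 1 because B permutes the lattice.\<close>

lemma torus_nn_integral_affine:
  fixes h :: "real^2 \<Rightarrow> ennreal"
  assumes AB: "A ** B = mat 1" "B ** A = mat 1" "\<bar>det B\<bar> = 1" and int: "int_matrix A" "int_matrix B"
    and [measurable]: "h \<in> borel_measurable borel" and per: "periodic_T2 h"
  shows "(\<integral>\<^sup>+x. h (A *v x + w) * indicator half_cell x \<partial>lborel)
    = (\<integral>\<^sup>+x. h x * indicator half_cell x \<partial>lborel)"
proof -
  have [measurable]: "(*v) M \<in> borel_measurable borel" for M :: "real^2^2"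
    by (intro borel_measurable_continuous_onI matrix_vector_mult_linear_continuous_on)
  define \<sigma> where "\<sigma> = (\<lambda>M k. (\<chi> i. \<Sum>j\<in>UNIV. \<lfloor>(M::real^2^2) $ i $ j\<rfloor> * k $ j) :: int^2)"
  have lv: "A *v lattice_vec k = lattice_vec (\<sigma> A k)" "B *v lattice_vec k = lattice_vec (\<sigma> B k)" for k
    using int by (simp_all add: int_matrix_lattice_vec \<sigma>_def)
  have "lattice_vec (\<sigma> A (\<sigma> B k)) = lattice_vec k" "lattice_vec (\<sigma> B (\<sigma> A k)) = lattice_vec k" for k
    using AB by (simp_all flip: lv add: matrix_vector_mul_assoc)
  then have bij: "bij (\<sigma> B)"
    using inj_lattice_vec by (intro o_bij[of "\<sigma> A"]) (auto simp: inj_eq)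
  let ?g = "\<lambda>y. h (y + w) * indicator half_cell (B *v y)"
  have "(\<integral>\<^sup>+x. h (A *v x + w) * indicator half_cell x \<partial>lborel) = (\<integral>\<^sup>+x. ?g (A *v x) \<partial>lborel)"
    using AB by (simp add: matrix_vector_mul_assoc)
  also have "\<dots> = (\<integral>\<^sup>+y. ?g y \<partial>distr lborel borel ((*v) A))"
    by (rule nn_integral_distr[symmetric]) auto
  also have "\<dots> = (\<integral>\<^sup>+y. ?g y \<partial>lborel)"
    by (simp add: lborel_distr_matrix[OF AB])
  also have "\<dots> = (\<integral>\<^sup>+y. ?g (y + - w) \<partial>lborel)"
    by (rule nn_integral_translate[symmetric]) auto
  also have "\<dots> = (\<integral>\<^sup>+y. h y * indicator half_cell (B *v (y - w)) \<partial>lborel)"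
    by simp
  also have "\<dots> = (\<integral>\<^sup>+y. (\<integral>\<^sup>+k. h (y + lattice_vec k)
      * indicator half_cell (B *v (y + lattice_vec k - w)) \<partial>count_space UNIV) * indicator half_cell y \<partial>lborel)"
    by (rule nn_integral_fold) auto
  also have "\<dots> = (\<integral>\<^sup>+y. (h y * (\<integral>\<^sup>+k. indicator half_cell (B *v (y - w) + lattice_vec (\<sigma> B k))
      \<partial>count_space UNIV)) * indicator half_cell y \<partial>lborel)"
    by (simp flip: lv nn_integral_cmult
        add: periodic_T2_lattice[OF per] matrix_vector_mult_diff_distrib matrix_vector_right_distrib algebra_simps)
  finally show ?thesis
    by (simp add: nn_integral_one_translate[OF bij])
qed

text \<open>The positive and negative parts bring the nonnegative change of variables to bear on
  real functions; the closed and the half-open cell differ by a null set of edges.\<close>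

lemma torus_avg_half_cell:
  assumes h: "continuous_on UNIV h"
  shows "torus_avg h = (enn2real (\<integral>\<^sup>+x. ennreal (h x) * indicator half_cell x \<partial>lborel)
    - enn2real (\<integral>\<^sup>+x. ennreal (- h x) * indicator half_cell x \<partial>lborel)) / (2 * pi)\<^sup>2"
proof -
  have ae: "AE x in lborel. x \<in> cell \<longleftrightarrow> x \<in> half_cell"
  proof (rule AE_I')
    have "negligible (cell - box 0 (vec (2 * pi)))" by (rule negligible_frontier_interval)
    then have "cell - box 0 (vec (2 * pi)) \<in> null_sets lebesgue" by (simp add: negligible_iff_null_sets)
    then show "cell - box 0 (vec (2 * pi)) \<in> null_sets lborel" by (simp add: null_sets_completion_iff)
    show "{x \<in> space lborel. \<not> (x \<in> cell \<longleftrightarrow> x \<in> half_cell)} \<subseteq> cell - box 0 (vec (2 * pi))"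
      by (auto simp: half_cell_def mem_box_cart intro: less_imp_le)
  qed
  have "(\<integral>\<^sup>+x. ennreal (s * (indicator cell x * h x)) \<partial>lborel)
    = (\<integral>\<^sup>+x. ennreal (s * h x) * indicator half_cell x \<partial>lborel)" for s
    by (intro nn_integral_cong_AE) (use ae in \<open>auto elim!: eventually_mono simp: indicator_def\<close>)
  from this[of 1] this[of "-1"] show ?thesis
    using set_integrable_cell[OF h] unfolding torus_avg_def set_lebesgue_integral_def set_integrable_def
    by (simp add: real_lebesgue_integral_def)
qed

lemma torus_avg_affine:
  assumes AB: "A ** B = mat 1" "B ** A = mat 1" "\<bar>det B\<bar> = 1" and int: "int_matrix A" "int_matrix B"
    and h: "continuous_on UNIV h" "periodic_T2 h"
  shows "torus_avg (\<lambda>x. h (A *v x + w)) = torus_avg h"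
proof -
  have "continuous_on UNIV (\<lambda>x. h (A *v x + w))"
    by (intro continuous_on_compose2[OF h(1)] continuous_intros matrix_vector_mult_linear_continuous_on) auto
  moreover have "h \<in> borel_measurable borel"
    using h by (simp add: borel_measurable_continuous_onI)
  moreover have "periodic_T2 (\<lambda>x. ennreal (h x))" "periodic_T2 (\<lambda>x. ennreal (- h x))"
    using h(2) by (simp_all add: periodic_T2_def)
  ultimately show ?thesis
    using h(1) torus_nn_integral_affine[OF AB int, of "\<lambda>x. ennreal (h x)" w]
      torus_nn_integral_affine[OF AB int, of "\<lambda>x. ennreal (- h x)" w]
    by (simp add: torus_avg_half_cell)
qed

lemma torus_avg_translate:
  assumes "continuous_on UNIV h" "periodic_T2 h"
  shows "torus_avg (\<lambda>x. h (x + w)) = torus_avg h"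
proof -
  have "int_matrix (mat 1)" by (simp add: int_matrix_def mat_def)
  then show ?thesis
    using torus_avg_affine[of "mat 1" "mat 1" h w] assms by simp
qed

section \<open>Hyperbolic toral automorphisms\<close>

text \<open>\<open>c1\<close> and \<open>c2\<close> are the coordinates in the eigenbasis. The
  eigenvectors are not normalized; \<kappa> records how far a fundamental cell extends in these
  coordinates and enters only the boundary terms of parallelogram averages.\<close>

locale hyperbolic_toral =
  fixes A B :: "real^2^2" and \<nu> \<mu> :: real and eu es :: "real^2"
    and c1 c2 :: "real^2 \<Rightarrow> real" and \<kappa> :: real
  assumes AB: "A ** B = mat 1" and BA: "B ** A = mat 1" and det_B: "\<bar>det B\<bar> = 1"
    and int_A: "int_matrix A" and int_B: "int_matrix B"
    and A_eu: "A *v eu = \<nu> *\<^sub>R eu" and A_es: "A *v es = \<mu> *\<^sub>R es"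
    and nu_gt_1: "\<bar>\<nu>\<bar> > 1" and mu_nu: "\<bar>\<mu>\<bar> * \<bar>\<nu>\<bar> = 1"
    and coords: "x = c1 x *\<^sub>R eu + c2 x *\<^sub>R es"
    and c1_le: "x \<in> cell \<Longrightarrow> \<bar>c1 x\<bar> \<le> \<kappa>" and c2_le: "x \<in> cell \<Longrightarrow> \<bar>c2 x\<bar> \<le> \<kappa>"

lemma eigenvalues_of_anosov:
  assumes A: "anosov_automorphism A"
  obtains \<nu> \<mu> where "\<bar>\<nu>\<bar> > 1" "\<nu> + \<mu> = A $ 1 $ 1 + A $ 2 $ 2" "\<nu> * \<mu> = det A" "\<nu> \<noteq> \<mu>" "A $ 1 $ 2 \<noteq> 0"
proof -
  define a b c d where "a = A $ 1 $ 1" "b = A $ 1 $ 2" "c = A $ 2 $ 1" "d = A $ 2 $ 2"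
  note abcd = this
  define t where "t = a + d"
  define D where "D = det A"
  have D: "D = a * d - b * c" "\<bar>D\<bar> = 1"
    using A by (auto simp: D_def abcd det_2 anosov_automorphism_def)
  have hyp: "cmod l \<noteq> 1" if "v \<noteq> 0"
    "complex_of_real a * v $ 1 + complex_of_real b * v $ 2 = l * v $ 1"
    "complex_of_real c * v $ 1 + complex_of_real d * v $ 2 = l * v $ 2" for l and v :: "complex^2"
  proof -
    have "(\<chi> i j. complex_of_real (A $ i $ j)) *v v = l *s v"
      using that by (simp add: vec_eq_iff forall_2 matrix_vector_mult_def UNIV_2 abcd)
    then show ?thesis using A \<open>v \<noteq> 0\<close> unfolding anosov_automorphism_def by blast
  qed
  \<comment> \<open>For b = 0 the diagonal entries are integers whose product has modulus 1, so d is
    an eigenvalue of modulus 1 with eigenvector (0, 1).\<close>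
  have b: "b \<noteq> 0"
  proof
    assume "b = 0"
    then have "\<bar>a\<bar> * \<bar>d\<bar> = 1" using D by (simp add: abs_mult)
    moreover have "d \<in> \<int>" "a \<in> \<int>" using A by (auto simp: abcd anosov_automorphism_def)
    ultimately have "\<bar>d\<bar> = 1"
    proof -
      have "a \<noteq> 0" "d \<noteq> 0" using \<open>\<bar>a\<bar> * \<bar>d\<bar> = 1\<close> by auto
      then have "\<bar>a\<bar> \<ge> 1" "\<bar>d\<bar> \<ge> 1" using Ints_nonzero_abs_ge1 \<open>d \<in> \<int>\<close> \<open>a \<in> \<int>\<close> by auto
      moreover have "\<bar>d\<bar> \<le> \<bar>a\<bar> * \<bar>d\<bar>" using calculation by (simp add: mult_le_cancel_right1)
      ultimately show ?thesis using \<open>\<bar>a\<bar> * \<bar>d\<bar> = 1\<close> by linarith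
    qed
    moreover have "axis 2 1 \<noteq> (0 :: complex^2)" by (simp add: axis_eq_0_iff)
    ultimately show False
      using hyp[of "axis 2 1" "complex_of_real d"] \<open>b = 0\<close> by (simp add: axis_def)
  qed
  \<comment> \<open>The vector (b, l - a) satisfies the first row of the eigenvalue equation
    identically, and the second row is the characteristic equation; it is nonzero because b
    is.\<close>
  have root: "cmod l \<noteq> 1" if "l\<^sup>2 - of_real t * l + of_real D = 0" for l :: complex
  proof (rule hyp[of "vector [of_real b, l - of_real a]"])
    show "vector [complex_of_real b, l - complex_of_real a] \<noteq> (0 :: complex^2)"
      using b by (auto simp: vec_eq_iff forall_2)
    show "complex_of_real c * (vector [complex_of_real b, l - complex_of_real a] :: complex^2) $ 1 +
        complex_of_real d * (vector [complex_of_real b, l - complex_of_real a] :: complex^2) $ 2 =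
        l * (vector [complex_of_real b, l - complex_of_real a] :: complex^2) $ 2"
      using that by (simp add: D t_def power2_eq_square algebra_simps)
  qed (simp add: algebra_simps)
  have rroot: "\<bar>x\<bar> \<noteq> 1" if "x\<^sup>2 - t * x + D = 0" for x :: real
  proof -
    have "complex_of_real (x\<^sup>2 - t * x + D) = 0" using that by simp
    then show ?thesis using root[of "of_real x"] by simp
  qed
  define \<Delta> where "\<Delta> = t\<^sup>2 - 4 * D"
  \<comment> \<open>Otherwise 4 * D is at least t^2, hence D = 1, and the root with real part t / 2
    has squared modulus D = 1, contrary to hyperbolicity.\<close>
  have "\<Delta> > 0"
  proof (rule ccontr)
    assume "\<not> \<Delta> > 0"
    then have neg: "- \<Delta> \<ge> 0" by simp
    have "t\<^sup>2 \<ge> 0" by simp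
    then have D1: "D = 1" using neg D(2) unfolding \<Delta>_def by linarith
    define l where "l = Complex (t / 2) (sqrt (- \<Delta>) / 2)"
    have sq: "sqrt (- \<Delta>) * sqrt (- \<Delta>) = 4 * D - t * t"
      using neg by (simp add: \<Delta>_def power2_eq_square)
    have "l\<^sup>2 - of_real t * l + of_real D = 0"
      using sq by (simp add: l_def complex_eq_iff power2_eq_square field_simps)
    moreover have "(cmod l)\<^sup>2 = 1"
      unfolding cmod_power2 using sq D1 by (simp add: l_def power2_eq_square field_simps)
    ultimately show False using root[of l] norm_ge_zero[of l] unfolding power2_eq_1_iff by linarith
  qed
  define s where "s = sqrt \<Delta>"
  have s: "s > 0" "s * s = t\<^sup>2 - 4 * D" using \<open>\<Delta> > 0\<close> by (auto simp: s_def \<Delta>_def)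
  define x y where "x = (t + s) / 2" "y = (t - s) / 2"
  have xy: "x + y = t" "x * y = D" "x \<noteq> y"
    using s by (auto simp: x_y_def field_simps power2_eq_square)
  have "x\<^sup>2 - t * x + D = 0" "y\<^sup>2 - t * y + D = 0"
    using xy(1,2) by (auto simp: power2_eq_square algebra_simps simp flip: xy(1,2))
  then have "\<bar>x\<bar> \<noteq> 1" "\<bar>y\<bar> \<noteq> 1" using rroot by auto
  moreover have "\<bar>x\<bar> * \<bar>y\<bar> = 1" using xy D by (simp flip: abs_mult)
  ultimately have "\<bar>x\<bar> > 1 \<or> \<bar>y\<bar> > 1"
    using mult_left_le_one_le[of "\<bar>y\<bar>" "\<bar>x\<bar>"] by (smt (verit))
  then show ?thesis
    using that[of x y] that[of y x] xy b by (auto simp: t_def D_def abcd algebra_simps)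
qed

lemma hyperbolic_toral_ex:
  assumes A: "anosov_automorphism A"
  shows "\<exists>B \<nu> \<mu> eu es c1 c2 \<kappa>. hyperbolic_toral A B \<nu> \<mu> eu es c1 c2 \<kappa>"
proof -
  obtain \<nu> \<mu> where lm: "\<bar>\<nu>\<bar> > 1" "\<nu> + \<mu> = A $ 1 $ 1 + A $ 2 $ 2" "\<nu> * \<mu> = det A" "\<nu> \<noteq> \<mu>" "A $ 1 $ 2 \<noteq> 0"
    using eigenvalues_of_anosov[OF A] by metis
  define a b c d where "a = A $ 1 $ 1" "b = A $ 1 $ 2" "c = A $ 2 $ 1" "d = A $ 2 $ 2"
  note abcd = this
  define D where "D = det A"
  have D: "D = a * d - b * c" "\<bar>D\<bar> = 1"
    using A by (auto simp: D_def abcd det_2 anosov_automorphism_def)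
  then have DD1: "D * D = 1" by (metis abs_mult_self_eq mult_1_right)
  have ints: "a \<in> \<int>" "b \<in> \<int>" "c \<in> \<int>" "d \<in> \<int>" "D \<in> \<int>"
    using A by (auto simp: abcd D_def det_2 anosov_automorphism_def)
  have A_eq: "A = vector [vector [a, b], vector [c, d]]"
    by (simp add: vec_eq_iff forall_2 abcd)
  \<comment> \<open>D times the adjugate: since D = 1 or D = -1, this is the inverse, and its
    entries are integers.\<close>
  define B :: "real^2^2" where "B = vector [vector [D * d, - D * b], vector [- D * c, D * a]]"
  have DD: "D * (a * d) - D * (b * c) = 1" using DD1 D(1) by (simp flip: right_diff_distrib)
  define eu es :: "real^2" where "eu = vector [b, \<nu> - a]" and "es = vector [b, \<mu> - a]"
  \<comment> \<open>Solves x = c1 * eu + c2 * es: the first components give c1 + c2 = x1 / b, and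
    substituting this into the second leaves c1 * (\<nu> - \<mu>).\<close>
  define c1 c2 :: "real^2 \<Rightarrow> real"
    where "c1 = (\<lambda>x. (x $ 2 + (a - \<mu>) * x $ 1 / b) / (\<nu> - \<mu>))"
      and "c2 = (\<lambda>x. x $ 1 / b - c1 x)"
  have cont: "continuous_on cell c1" "continuous_on cell c2"
    unfolding c2_def c1_def by (auto intro!: continuous_intros simp: lm abcd)
  have "bounded (c1 ` cell)" "bounded (c2 ` cell)"
    by (auto intro!: compact_imp_bounded compact_continuous_image cont)
  then obtain k1 k2 where k: "\<And>x. x \<in> cell \<Longrightarrow> \<bar>c1 x\<bar> \<le> k1" "\<And>x. x \<in> cell \<Longrightarrow> \<bar>c2 x\<bar> \<le> k2"
    by (auto simp: bounded_iff)
  have lm': "\<nu> + \<mu> = a + d" "\<nu> * \<mu> = a * d - b * c" "b \<noteq> 0" "\<nu> - \<mu> \<noteq> 0"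
    using lm D by (auto simp: abcd D_def)
  have e1: "x $ 1 = c1 x * b + c2 x * b" for x using lm' by (simp add: c2_def field_simps)
  have e2: "x $ 2 = c1 x * (\<nu> - a) + c2 x * (\<mu> - a)" for x
  proof -
    have "c1 x * (\<nu> - a) + c2 x * (\<mu> - a) = c1 x * (\<nu> - \<mu>) + (\<mu> - a) * (x $ 1 / b)"
      by (simp add: c2_def algebra_simps)
    also have "\<dots> = x $ 2" using lm' by (simp add: c1_def) (simp add: field_simps)
    finally show ?thesis by simp
  qed
  have "hyperbolic_toral A B \<nu> \<mu> eu es c1 c2 (max k1 k2)"
  proof
    show "A ** B = mat 1" "B ** A = mat 1"
      using DD by (simp_all add: A_eq B_def vec_eq_iff forall_2 matrix_matrix_mult_def UNIV_2 mat_def algebra_simps)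
    have "det B = D * D * (a * d - b * c)" by (simp add: B_def det_2 algebra_simps)
    then show "\<bar>det B\<bar> = 1" using D DD1 by simp
    show "int_matrix A" "int_matrix B"
      using ints by (simp_all add: int_matrix_def A_eq B_def forall_2)
    have r: "\<nu> * \<nu> = \<nu> * (a + d) - (a * d - b * c)" "\<mu> * \<mu> = \<mu> * (a + d) - (a * d - b * c)"
      by (simp_all flip: lm'(1,2) add: algebra_simps)
    show "A *v eu = \<nu> *\<^sub>R eu" "A *v es = \<mu> *\<^sub>R es"
      using r by (simp_all add: A_eq eu_def es_def vec_eq_iff forall_2 matrix_vector_mult_def UNIV_2 algebra_simps)
    show "\<bar>\<nu>\<bar> > 1" by (rule lm)
    have "\<bar>\<mu> * \<nu>\<bar> = 1" using lm(3) D(2) by (simp add: D_def mult.commute)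
    then show "\<bar>\<mu>\<bar> * \<bar>\<nu>\<bar> = 1" by (simp add: abs_mult)
    show "x = c1 x *\<^sub>R eu + c2 x *\<^sub>R es" for x
      using e1[of x] e2[of x] by (simp add: vec_eq_iff forall_2 eu_def es_def)
  qed (use k in \<open>auto simp: max.coboundedI1 max.coboundedI2\<close>)
  then show ?thesis by blast
qed

section \<open>Continuity, periodicity and averages under iteration of the automorphism\<close>

lemma continuous_on_compose_curried:
  fixes G :: "'a::topological_space \<Rightarrow> 'b::topological_space \<Rightarrow> 'c::topological_space"
  assumes "continuous_on UNIV (\<lambda>(x, y). G x y)" "continuous_on S p" "continuous_on S q"
  shows "continuous_on S (\<lambda>z. G (p z) (q z))"
  using continuous_on_compose2[OF assms(1) continuous_on_Pair[OF assms(2,3)]] by simp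

lemma periodic_T2_int_matrix:
  assumes M: "int_matrix M" and "periodic_T2 h"
  shows "periodic_T2 (\<lambda>x. h (M *v x))"
  unfolding periodic_T2_def
proof (intro allI)
  fix x i
  have "axis i (2 * pi) = lattice_vec (axis i 1)"
    by (simp add: lattice_vec_def axis_def vec_eq_iff)
  then show "h (M *v (x + axis i (2 * pi))) = h (M *v x)"
    by (simp add: matrix_vector_right_distrib int_matrix_lattice_vec[OF M] periodic_T2_lattice[OF assms(2)])
qed

lemma continuous_on_matrix_vector [continuous_intros]:
  fixes M :: "real^'n^'m"
  shows "continuous_on S p \<Longrightarrow> continuous_on S (\<lambda>x. M *v p x)"
  by (rule continuous_on_compose2[OF matrix_vector_mult_linear_continuous_on]) auto

context hyperbolic_toral
begin

abbreviation T :: "nat \<Rightarrow> real^2 \<Rightarrow> real^2" where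
  "T n \<equiv> (*v) A ^^ n"

lemma T_add: "T n (x + y) = T n x + T n y"
  by (induction n) (simp_all add: matrix_vector_right_distrib)

lemma T_scaleR: "T n (c *\<^sub>R x) = c *\<^sub>R T n x"
  by (induction n) (simp_all add: matrix_vector_mult_scaleR)

lemma T_eu: "T n eu = \<nu> ^ n *\<^sub>R eu"
  by (induction n) (simp_all add: matrix_vector_mult_scaleR A_eu mult.commute)

lemma T_es: "T n es = \<mu> ^ n *\<^sub>R es"
  by (induction n) (simp_all add: matrix_vector_mult_scaleR A_es mult.commute)

lemma continuous_on_T [continuous_intros]:
  "continuous_on S p \<Longrightarrow> continuous_on S (\<lambda>x. T n (p x))"
  by (induction n) (auto intro!: continuous_intros)

lemma periodic_T2_A:
  "periodic_T2 h \<Longrightarrow> periodic_T2 (\<lambda>x. h (A *v x))"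
  by (rule periodic_T2_int_matrix[OF int_A])

lemma periodic_T2_T:
  assumes "periodic_T2 h"
  shows "periodic_T2 (\<lambda>x. h (T n x))"
  by (induction n) (use assms periodic_T2_A in \<open>auto simp: funpow_swap1 simp del: funpow.simps(2)
    simp: funpow_Suc_right\<close>)

lemma torus_avg_A:
  assumes "continuous_on UNIV h" "periodic_T2 h"
  shows "torus_avg (\<lambda>x. h (A *v x)) = torus_avg h"
  using torus_avg_affine[OF AB BA det_B int_A int_B assms, of 0] by simp

lemma torus_avg_T:
  assumes "continuous_on UNIV h" "periodic_T2 h"
  shows "torus_avg (\<lambda>x. h (T n x)) = torus_avg h"
proof (induction n)
  case (Suc n)
  have "torus_avg (\<lambda>x. h (T n (A *v x))) = torus_avg (\<lambda>x. h (T n x))"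
    by (intro torus_avg_A periodic_T2_T assms continuous_on_compose2[OF assms(1)])
       (auto intro!: continuous_intros)
  then show ?case by (simp add: Suc funpow_swap1)
qed simp

lemma \<kappa>_nonneg: "0 \<le> \<kappa>"
  using c1_le[of 0] by (simp add: cell_iff)

text \<open>Averaging over a parallelogram and over its translates by the points of a fundamental cell
  differ only by boundary terms, and the latter averages equal the mean on the torus.\<close>

lemma torus_avg_parallelogram:
  assumes v: "continuous_on UNIV v" "periodic_T2 v" and H: "\<And>x. \<bar>v x\<bar> \<le> H"
    and ab: "a \<noteq> 0" "b \<noteq> 0"
  shows "\<bar>torus_avg (\<lambda>w. v (x + (a * w $ 1) *\<^sub>R eu + (b * w $ 2) *\<^sub>R es)) - torus_avg v\<bar>
    \<le> H * (\<kappa> / \<bar>a\<bar> + \<kappa> / \<bar>b\<bar>)"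
proof -
  have H0: "0 \<le> H" using H[of 0] by simp
  define L :: "real^2 \<Rightarrow> real^2" where "L w = x + (a * w $ 1) *\<^sub>R eu + (b * w $ 2) *\<^sub>R es" for w
  have contL [continuous_intros]: "continuous_on S p \<Longrightarrow> continuous_on S (\<lambda>z. L (p z))" for S and p :: "'z::topological_space \<Rightarrow> _"
    unfolding L_def by (intro continuous_intros)
  \<comment> \<open>For each fixed w the inner average over q is the torus mean, so the outer
    average is over a constant. After the swap, the inner averages run over translates of one
    parallelogram.\<close>
  have "torus_avg v = torus_avg (\<lambda>w. torus_avg (\<lambda>q. v (L w + q)))"
    using torus_avg_translate[OF v, of "L _"] by (simp add: add.commute)
  also have "\<dots> = torus_avg (\<lambda>q. torus_avg (\<lambda>w. v (L w + q)))"
    by (rule torus_avg_swap)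
       (auto intro!: continuous_intros continuous_on_compose2[OF v(1)] simp: case_prod_beta)
  finally have eq: "torus_avg v = \<dots>" .
  have "\<bar>torus_avg (\<lambda>q. torus_avg (\<lambda>w. v (L w + q))) - torus_avg (\<lambda>w. v (L w))\<bar>
    \<le> H * (\<kappa> / \<bar>a\<bar> + \<kappa> / \<bar>b\<bar>)"
  proof (rule torus_avg_dist_le)
    show "continuous_on UNIV (\<lambda>q. torus_avg (\<lambda>w. v (L w + q)))"
      by (rule continuous_on_torus_avg)
         (auto intro!: continuous_intros continuous_on_compose2[OF v(1)] simp: case_prod_beta)
    fix q :: "real^2" assume q: "q \<in> cell"
    \<comment> \<open>The parameter shift that realizes the translation by q; it is small when the
      sides a and b are long.\<close>
    define q' :: "real^2" where "q' = vector [c1 q / a, c2 q / b]"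
    have "L (w + q') = L w + q" for w
      using ab by (subst coords[of q]) (simp add: L_def q'_def algebra_simps)
    then have "\<bar>torus_avg (\<lambda>w. v (L w + q)) - torus_avg (\<lambda>w. v (L w))\<bar> \<le> H * (\<bar>q' $ 1\<bar> + \<bar>q' $ 2\<bar>)"
      using torus_avg_shift_diff[of "\<lambda>w. v (L w)" H q'] H
        continuous_on_compose2[OF v(1) contL[OF continuous_on_id]] by simp
    also have "\<dots> \<le> H * (\<kappa> / \<bar>a\<bar> + \<kappa> / \<bar>b\<bar>)"
      using c1_le[OF q] c2_le[OF q] H0
      by (intro mult_left_mono add_mono) (auto simp: q'_def abs_divide divide_right_mono)
    finally show "\<bar>torus_avg (\<lambda>w. v (L w + q)) - torus_avg (\<lambda>w. v (L w))\<bar> \<le> H * (\<kappa> / \<bar>a\<bar> + \<kappa> / \<bar>b\<bar>)" .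
  qed
  then show ?thesis using eq by (simp add: L_def abs_minus_commute)
qed

end

section \<open>Decay of correlations\<close>

text \<open>Regularity of the first argument is required only along the expanding direction.\<close>

definition unstable_holder :: "real^2 \<Rightarrow> real \<Rightarrow> real \<Rightarrow> (real^2 \<Rightarrow> real^2 \<Rightarrow> real) \<Rightarrow> bool" where
  "unstable_holder e \<alpha> K G \<longleftrightarrow>
     continuous_on UNIV (\<lambda>(\<psi>, y). G \<psi> y) \<and>
     (\<forall>y. periodic_T2 (\<lambda>\<psi>. G \<psi> y)) \<and> (\<forall>\<psi>. periodic_T2 (G \<psi>)) \<and>
     (\<forall>\<psi>. torus_avg (G \<psi>) = 0) \<and> (\<forall>\<psi> y. \<bar>G \<psi> y\<bar> \<le> K) \<and>
     (\<forall>\<psi> y y'. \<bar>G \<psi> y' - G \<psi> y\<bar> \<le> K * norm (y' - y) powr \<alpha>) \<and>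
     (\<forall>\<psi> y t. \<bar>G (\<psi> + t *\<^sub>R e) y - G \<psi> y\<bar> \<le> K * \<bar>t\<bar> powr \<alpha>)"

context hyperbolic_toral
begin

lemma mu_pos: "0 < \<bar>\<mu>\<bar>" and mu_less_1: "\<bar>\<mu>\<bar> < 1" and nu_eq: "\<bar>\<nu>\<bar> = 1 / \<bar>\<mu>\<bar>"
proof -
  show "0 < \<bar>\<mu>\<bar>" using mu_nu by (auto intro: ccontr)
  then show "\<bar>\<nu>\<bar> = 1 / \<bar>\<mu>\<bar>" using mu_nu by (simp add: field_simps)
  show "\<bar>\<mu>\<bar> < 1" using nu_gt_1 mu_nu mult_right_mono[of 1 "\<bar>\<mu>\<bar>" "\<bar>\<nu>\<bar>"] by linarith
qed

text \<open>Shifting \<open>\<psi>\<close> by \<open>S w\<^sub>1 e\<^sub>u\<close> and perturbing \<open>A\<^sup>n \<psi>\<close> by \<open>\<mu>\<^sup>n R w\<^sub>2 e\<^sub>s\<close> costs little; after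
  \<open>2 k\<close> iterations the parallelogram with sides \<open>S\<close> and \<open>R\<close> has both sides of length \<open>\<bar>\<nu>\<bar>\<^sup>k\<close>.\<close>

lemma correlation_bound_step:
  assumes \<alpha>: "0 < \<alpha>" "\<alpha> \<le> 1" and G: "unstable_holder eu \<alpha> K G" and n: "4 * k \<le> n"
  shows "\<bar>torus_avg (\<lambda>\<psi>. G \<psi> (T n \<psi>))\<bar>
    \<le> K * ((2 * pi) powr \<alpha> + (2 * pi * norm es) powr \<alpha> + 2 * \<kappa>) * (\<bar>\<mu>\<bar> powr \<alpha>) ^ k"
proof -
  have cont: "continuous_on UNIV (\<lambda>(\<psi>, y). G \<psi> y)"
    and per1: "\<And>y. periodic_T2 (\<lambda>\<psi>. G \<psi> y)" and per2: "\<And>\<psi>. periodic_T2 (G \<psi>)"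
    and zero: "\<And>\<psi>. torus_avg (G \<psi>) = 0" and bound: "\<And>\<psi> y. \<bar>G \<psi> y\<bar> \<le> K"
    and hold: "\<And>\<psi> y y'. \<bar>G \<psi> y' - G \<psi> y\<bar> \<le> K * norm (y' - y) powr \<alpha>"
    and unst: "\<And>\<psi> y t. \<bar>G (\<psi> + t *\<^sub>R eu) y - G \<psi> y\<bar> \<le> K * \<bar>t\<bar> powr \<alpha>"
    using G unfolding unstable_holder_def by blast+
  have K0: "0 \<le> K" using bound[of 0 0] by simp
  define r where "r = \<bar>\<mu>\<bar>"
  have r: "0 < r" "r < 1" "\<bar>\<nu>\<bar> = 1 / r" using mu_pos mu_less_1 nu_eq by (auto simp: r_def)
  \<comment> \<open>The exponents balance three demands: the shift S is small; after
    \<open>2 * k\<close> iterations both sides equal 1 / S, as r^(-2k) * S = r^(2k) * R = 1 / S; and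
    at time n the contracted side r^n * R is at most S, which is where \<open>4 * k \<le> n\<close>
    is used.\<close>
  define S where "S = r ^ k"
  define R where "R = (1 / r) ^ (3 * k)"
  have SR: "S > 0" "R > 0" using r by (auto simp: S_def R_def)
  \<comment> \<open>Only the second argument of G is displaced, by the image under
    \<open>T n\<close> of the displacement S * w1 * eu + R * w2 * es. The first argument could not
    follow, as nothing is known about G along \<open>es\<close> there.\<close>
  define J where "J = (\<lambda>(w::real^2) \<psi>. G \<psi> (T n \<psi> + (\<nu> ^ n * (S * w $ 1)) *\<^sub>R eu + (\<mu> ^ n * (R * w $ 2)) *\<^sub>R es))"
  define e where "e = K * (2 * pi * S) powr \<alpha> + K * (2 * pi * norm es * S) powr \<alpha>"
  note ci = continuous_on_compose_curried[OF cont] continuous_intros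
  have contJ: "continuous_on UNIV (\<lambda>(w, \<psi>). J w \<psi>)" "continuous_on UNIV (\<lambda>(\<psi>, w). J w \<psi>)"
    unfolding J_def case_prod_beta by (intro ci)+
  have perG: "periodic_T2 (\<lambda>\<psi>. G \<psi> (T n \<psi>))"
    using periodic_T2_T[OF per2] per1 unfolding periodic_T2_def by metis
  have step1: "\<bar>torus_avg (J w) - torus_avg (\<lambda>\<psi>. G \<psi> (T n \<psi>))\<bar> \<le> e" if w: "w \<in> cell" for w
  proof -
    let ?s = "S * w $ 1"
    have w': "\<bar>w $ 1\<bar> \<le> 2 * pi" "\<bar>w $ 2\<bar> \<le> 2 * pi" using w by (auto simp: cell_iff)
    \<comment> \<open>Translating the whole correlation by ?s * eu produces exactly the expanding
      term of J, however large it is; only the shift in the first argument and the contracted term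
      remain as errors.\<close>
    have "torus_avg (\<lambda>\<psi>. G \<psi> (T n \<psi>)) = torus_avg (\<lambda>\<psi>. G (\<psi> + ?s *\<^sub>R eu) (T n (\<psi> + ?s *\<^sub>R eu)))"
      by (rule torus_avg_translate[OF _ perG, symmetric]) (intro ci)
    also have "torus_avg (J w) - \<dots> = torus_avg (\<lambda>\<psi>. J w \<psi> - G (\<psi> + ?s *\<^sub>R eu) (T n (\<psi> + ?s *\<^sub>R eu)))"
      unfolding J_def by (rule torus_avg_diff[symmetric]) (intro ci)+
    also have "\<bar>\<dots>\<bar> \<le> e"
    proof (rule torus_avg_abs_le)
      show "continuous_on UNIV (\<lambda>\<psi>. J w \<psi> - G (\<psi> + ?s *\<^sub>R eu) (T n (\<psi> + ?s *\<^sub>R eu)))"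
        unfolding J_def by (intro ci)
      fix \<psi>
      let ?y = "T n (\<psi> + ?s *\<^sub>R eu)"
      have y: "?y = T n \<psi> + (\<nu> ^ n * ?s) *\<^sub>R eu"
        by (simp add: T_add T_scaleR T_eu mult.commute)
      have "\<bar>G \<psi> (?y + (\<mu> ^ n * (R * w $ 2)) *\<^sub>R es) - G \<psi> ?y\<bar>
          \<le> K * norm ((\<mu> ^ n * (R * w $ 2)) *\<^sub>R es) powr \<alpha>"
        using hold[of \<psi> "?y + (\<mu> ^ n * (R * w $ 2)) *\<^sub>R es" ?y] by simp
      also have "\<dots> \<le> K * (2 * pi * norm es * S) powr \<alpha>"
      proof (intro mult_left_mono powr_mono2 K0)
        have "norm ((\<mu> ^ n * (R * w $ 2)) *\<^sub>R es) = (r ^ n * R) * (\<bar>w $ 2\<bar> * norm es)"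
          using SR by (simp add: abs_mult power_abs r_def)
        also have "\<dots> \<le> S * (2 * pi * norm es)"
        proof (intro mult_mono mult_right_mono w')
          have "r ^ n * R \<le> r ^ (4 * k) * R"
            using r n SR by (intro mult_right_mono power_decreasing) auto
          also have "\<dots> = S"
            using r by (simp add: R_def S_def power_divide flip: power_diff)
          finally show "r ^ n * R \<le> S" .
        qed (use SR r in auto)
        finally show "norm ((\<mu> ^ n * (R * w $ 2)) *\<^sub>R es) \<le> 2 * pi * norm es * S" by (simp add: mult_ac)
      qed (use \<alpha> in auto)
      finally have "\<bar>G \<psi> (?y + (\<mu> ^ n * (R * w $ 2)) *\<^sub>R es) - G \<psi> ?y\<bar> \<le> \<dots>" .
      moreover have "\<bar>G (\<psi> + ?s *\<^sub>R eu) ?y - G \<psi> ?y\<bar> \<le> K * \<bar>?s\<bar> powr \<alpha>" by (rule unst)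
      moreover have "K * \<bar>?s\<bar> powr \<alpha> \<le> K * (2 * pi * S) powr \<alpha>"
        using w' SR \<alpha> by (intro mult_left_mono powr_mono2 K0) (auto simp: abs_mult)
      moreover have "J w \<psi> = G \<psi> (?y + (\<mu> ^ n * (R * w $ 2)) *\<^sub>R es)"
        by (simp add: J_def y)
      ultimately show "\<bar>J w \<psi> - G (\<psi> + ?s *\<^sub>R eu) ?y\<bar> \<le> e" unfolding e_def by linarith
    qed
    finally show ?thesis .
  qed
  have "\<bar>torus_avg (\<lambda>w. torus_avg (J w)) - torus_avg (\<lambda>\<psi>. G \<psi> (T n \<psi>))\<bar> \<le> e"
    by (intro torus_avg_dist_le step1 continuous_on_torus_avg contJ)
  moreover have "\<bar>torus_avg (\<lambda>\<psi>. torus_avg (\<lambda>w. J w \<psi>))\<bar> \<le> K * (2 * \<kappa> * S)"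
  proof (rule torus_avg_abs_le)
    show "continuous_on UNIV (\<lambda>\<psi>. torus_avg (\<lambda>w. J w \<psi>))"
      by (rule continuous_on_torus_avg[OF contJ(2)])
    fix \<psi>
    \<comment> \<open>With \<psi> frozen in the first argument, v is a mean-zero function of the
      point reached after \<open>2 * k\<close> steps, and J becomes its value on a parallelogram
      with both sides 1 / S.\<close>
    define v where "v = (\<lambda>y. G \<psi> (T (n - 2 * k) y))"
    define a b where "a = \<nu> ^ (2 * k) * S" "b = \<mu> ^ (2 * k) * R"
    have ab: "\<bar>a\<bar> = 1 / S" "\<bar>b\<bar> = 1 / S"
    proof -
      have "(1 / r) ^ (2 * k) = (1 / S)\<^sup>2" "r ^ (2 * k) = S\<^sup>2" "R = (1 / S) ^ 3"
        by (simp_all add: S_def R_def power_divide mult.commute flip: power_mult)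
      moreover have "\<bar>a\<bar> = (1 / r) ^ (2 * k) * S" using SR r by (simp add: a_b_def abs_mult power_abs)
      moreover have "\<bar>b\<bar> = r ^ (2 * k) * R" using SR by (simp add: a_b_def abs_mult power_abs r_def)
      ultimately show "\<bar>a\<bar> = 1 / S" "\<bar>b\<bar> = 1 / S"
        using SR by (simp_all add: power2_eq_square power3_eq_cube)
    qed
    have T_comp: "T (n - 2 * k) (T (2 * k) y) = T n y" for y
    proof -
      have "T n = T (n - 2 * k) \<circ> T (2 * k)" using n by (simp flip: funpow_add)
      then show ?thesis by simp
    qed
    have J_eq: "J w \<psi> = v (T (2 * k) \<psi> + (a * w $ 1) *\<^sub>R eu + (b * w $ 2) *\<^sub>R es)" for w
    proof -
      have "T (2 * k) \<psi> + (a * w $ 1) *\<^sub>R eu + (b * w $ 2) *\<^sub>R es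
          = T (2 * k) (\<psi> + (S * w $ 1) *\<^sub>R eu + (R * w $ 2) *\<^sub>R es)"
        by (simp add: T_add T_scaleR T_eu T_es a_b_def mult_ac)
      also have "T (n - 2 * k) \<dots> = T n (\<psi> + (S * w $ 1) *\<^sub>R eu + (R * w $ 2) *\<^sub>R es)"
        by (rule T_comp)
      also have "\<dots> = T n \<psi> + (\<nu> ^ n * (S * w $ 1)) *\<^sub>R eu + (\<mu> ^ n * (R * w $ 2)) *\<^sub>R es"
        by (simp add: T_add T_scaleR T_eu T_es mult_ac)
      finally show ?thesis by (simp add: v_def J_def)
    qed
    have contv: "continuous_on UNIV v" unfolding v_def by (intro ci)
    have avgv: "torus_avg v = 0"
      unfolding v_def using zero by (subst torus_avg_T) (auto intro!: ci per2)
    have ne: "a \<noteq> 0" "b \<noteq> 0" using ab SR by auto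
    have perv: "periodic_T2 v" unfolding v_def by (rule periodic_T2_T[OF per2])
    have "\<bar>v y\<bar> \<le> K" for y unfolding v_def by (rule bound)
    then have "\<bar>torus_avg (\<lambda>w. J w \<psi>) - torus_avg v\<bar> \<le> K * (\<kappa> / \<bar>a\<bar> + \<kappa> / \<bar>b\<bar>)"
      unfolding J_eq by (rule torus_avg_parallelogram[OF contv perv _ ne])
    then show "\<bar>torus_avg (\<lambda>w. J w \<psi>)\<bar> \<le> K * (2 * \<kappa> * S)"
      by (simp add: ab avgv mult_ac)
  qed
  moreover have "torus_avg (\<lambda>w. torus_avg (J w)) = torus_avg (\<lambda>\<psi>. torus_avg (\<lambda>w. J w \<psi>))"
    by (rule torus_avg_swap[OF contJ(1)])
  ultimately have "\<bar>torus_avg (\<lambda>\<psi>. G \<psi> (T n \<psi>))\<bar> \<le> e + K * (2 * \<kappa> * S)" by linarith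
  also have "\<dots> \<le> e + K * (2 * \<kappa> * S powr \<alpha>)"
  proof -
    \<comment> \<open>Since S and \<alpha> are at most 1, the boundary error S is absorbed into the
      slower Hoelder rate.\<close>
    have "S \<le> S powr \<alpha>"
      using powr_mono'[of \<alpha> 1 S] \<alpha> SR r by (simp add: S_def power_le_one)
    then show ?thesis
      using K0 \<kappa>_nonneg by (intro add_left_mono mult_left_mono) auto
  qed
  also have "\<dots> = K * ((2 * pi) powr \<alpha> + (2 * pi * norm es) powr \<alpha> + 2 * \<kappa>) * S powr \<alpha>"
    using SR by (simp add: e_def powr_mult algebra_simps)
  also have "S powr \<alpha> = (r powr \<alpha>) ^ k"
    using r by (simp add: S_def powr_power powr_powr mult.commute flip: powr_realpow)
  finally show ?thesis by (simp add: r_def)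
qed

text \<open>C and \<theta> are chosen before K and G, and K enters linearly, so a factor \<rho>
  contained in K survives in the bound.\<close>

lemma decay_of_correlations:
  assumes \<alpha>: "0 < \<alpha>" "\<alpha> \<le> 1"
  obtains C \<theta> where "0 \<le> C" "0 < \<theta>" "\<theta> < 1"
    "\<And>K G n. unstable_holder eu \<alpha> K G \<Longrightarrow> \<bar>torus_avg (\<lambda>\<psi>. G \<psi> (T n \<psi>))\<bar> \<le> K * C * \<theta> ^ n"
proof -
  define p where "p = \<bar>\<mu>\<bar> powr \<alpha>"
  have p: "0 < p" "p < 1"
    using mu_pos mu_less_1 \<alpha> powr_less_mono2[of \<alpha> "\<bar>\<mu>\<bar>" 1] by (auto simp: p_def)
  \<comment> \<open>The fourth root, because a gain of p is available once in every four
    steps.\<close>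
  define \<theta> where "\<theta> = p powr (1 / 4)"
  have \<theta>: "0 < \<theta>" "\<theta> < 1" using p powr_less_mono2[of "1/4" p 1] by (auto simp: \<theta>_def)
  have \<theta>4: "\<theta> ^ 4 = p" using p by (simp add: \<theta>_def powr_power)
  define D where "D = (2 * pi) powr \<alpha> + (2 * pi * norm es) powr \<alpha> + 2 * \<kappa>"
  have D0: "0 \<le> D" using \<kappa>_nonneg by (simp add: D_def)
  show thesis
  proof
    show "0 \<le> D / \<theta> ^ 3" "0 < \<theta>" "\<theta> < 1" using D0 \<theta> by auto
    fix K n and G assume G: "unstable_holder eu \<alpha> K G"
    then have K0: "0 \<le> K" unfolding unstable_holder_def by (meson abs_ge_zero order_trans)
    \<comment> \<open>The remainder of n modulo 4 is at most 3, which costs the factor 1 /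
      \<theta>^3 in the constant.\<close>
    have "\<theta> ^ (4 * (n div 4)) * \<theta> ^ 3 \<le> \<theta> ^ n"
      unfolding power_add[symmetric] by (rule power_decreasing) (use \<theta> in auto)
    then have le: "p ^ (n div 4) \<le> \<theta> ^ n / \<theta> ^ 3"
      using \<theta> by (simp add: power_mult \<theta>4 field_simps)
    have "\<bar>torus_avg (\<lambda>\<psi>. G \<psi> (T n \<psi>))\<bar> \<le> K * D * p ^ (n div 4)"
      unfolding D_def p_def by (rule correlation_bound_step[OF \<alpha> G]) simp
    also have "\<dots> \<le> K * D * (\<theta> ^ n / \<theta> ^ 3)"
      by (intro mult_left_mono le) (use K0 D0 in auto)
    finally show "\<bar>torus_avg (\<lambda>\<psi>. G \<psi> (T n \<psi>))\<bar> \<le> K * (D / \<theta> ^ 3) * \<theta> ^ n" by simp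
  qed
qed

end

section \<open>The invariant graph\<close>

lemma continuous_on_lipschitz_holder:
  fixes g :: "real \<Rightarrow> 'a::real_normed_vector \<Rightarrow> real"
  assumes lip: "\<And>x x' \<psi>. \<bar>g x \<psi> - g x' \<psi>\<bar> \<le> K * \<bar>x - x'\<bar>"
    and hold: "\<And>x \<psi> \<psi>'. \<bar>g x \<psi>' - g x \<psi>\<bar> \<le> H * norm (\<psi>' - \<psi>) powr \<alpha>" and \<alpha>: "0 < \<alpha>"
  shows "continuous_on UNIV (\<lambda>(x, \<psi>). g x \<psi>)"
proof -
  have "((\<lambda>p. g (fst p) (snd p)) \<longlongrightarrow> g x \<psi>) (at (x, \<psi>))" for x \<psi>
  proof (rule LIM_zero_cancel, rule Lim_null_comparison)
    show "\<forall>\<^sub>F p in at (x, \<psi>). norm (g (fst p) (snd p) - g x \<psi>)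
        \<le> K * \<bar>fst p - x\<bar> + H * norm (snd p - \<psi>) powr \<alpha>"
    proof (intro always_eventually allI)
      fix p :: "real \<times> 'a"
      show "norm (g (fst p) (snd p) - g x \<psi>) \<le> K * \<bar>fst p - x\<bar> + H * norm (snd p - \<psi>) powr \<alpha>"
        using lip[of "fst p" "snd p" x] hold[of x "snd p" \<psi>] by simp
    qed
    have f: "((\<lambda>p. norm (snd p - \<psi>)) \<longlongrightarrow> norm (snd (x, \<psi>) - \<psi>)) (at (x, \<psi>))"
      by (intro tendsto_intros)
    have "((\<lambda>p. norm (snd p - \<psi>) powr \<alpha>) \<longlongrightarrow> 0) (at (x, \<psi>))"
      using tendsto_powr'[OF f tendsto_const[of \<alpha>]] \<alpha> by simp
    moreover have "((\<lambda>p. \<bar>fst p - x\<bar>) \<longlongrightarrow> \<bar>fst (x, \<psi>) - x\<bar>) (at (x, \<psi>))"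
      by (intro tendsto_intros)
    ultimately have "((\<lambda>p. K * \<bar>fst p - x\<bar> + H * norm (snd p - \<psi>) powr \<alpha>) \<longlongrightarrow> K * \<bar>fst (x, \<psi>) - x\<bar> + H * 0) (at (x, \<psi>))"
      by (intro tendsto_intros)
    then show "((\<lambda>p. K * \<bar>fst p - x\<bar> + H * norm (snd p - \<psi>) powr \<alpha>) \<longlongrightarrow> 0) (at (x, \<psi>))"
      by simp
  qed
  then show ?thesis
    by (auto simp: continuous_on_def case_prod_beta)
qed

text \<open>The interval {a..b} will be the range between the infimum and supremum of the zeros of
  f, and f' the \<phi>-derivative. The signs at the two ends keep the fibre maps inside the
  interval, and the bounds by 1 reflect the normalization of the norm of f.\<close>

locale forced_skew_product = hyperbolic_toral +
  fixes f f' :: "real \<Rightarrow> real^2 \<Rightarrow> real" and \<alpha> H a b \<gamma> :: real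
  assumes \<alpha>: "0 < \<alpha>" "\<alpha> \<le> 1"
    and f_periodic: "periodic_T2 (f \<phi>)"
    and f_deriv: "((\<lambda>x. f x \<psi>) has_real_derivative f' \<phi> \<psi>) (at \<phi>)"
    and f_le: "\<bar>f \<phi> \<psi>\<bar> \<le> 1" and f'_le: "\<bar>f' \<phi> \<psi>\<bar> \<le> 1"
    and f'_lip: "\<bar>f' x \<psi> - f' y \<psi>\<bar> \<le> \<bar>x - y\<bar>"
    and f_holder: "\<bar>f \<phi> \<psi>' - f \<phi> \<psi>\<bar> \<le> H * norm (\<psi>' - \<psi>) powr \<alpha>"
    and f'_holder: "\<bar>f' \<phi> \<psi>' - f' \<phi> \<psi>\<bar> \<le> H * norm (\<psi>' - \<psi>) powr \<alpha>"
    and H_nonneg: "0 \<le> H"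
    and ab: "0 \<in> {a..b}" and \<gamma>_pos: "0 < \<gamma>"
    and f'_neg: "\<phi> \<in> {a..b} \<Longrightarrow> f' \<phi> \<psi> \<le> - \<gamma>"
    and f_a: "0 \<le> f a \<psi>" and f_b: "f b \<psi> \<le> 0"
begin

section \<open>Mean value estimates and contraction of the fibre maps\<close>

lemma f_mvt:
  obtains z where "min x y \<le> z" "z \<le> max x y" "f x \<psi> - f y \<psi> = (x - y) * f' z \<psi>"
proof -
  have *: "\<exists>z\<ge>u. z \<le> v \<and> f v \<psi> - f u \<psi> = (v - u) * f' z \<psi>" if "u < v" for u v
    using MVT2[OF that, of "\<lambda>x. f x \<psi>" "\<lambda>x. f' x \<psi>"] f_deriv by (auto intro: less_imp_le)
  consider "x < y" | "x = y" | "y < x" by linarith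
  then show thesis
  proof cases
    case 1
    then obtain z where "x \<le> z" "z \<le> y" "f y \<psi> - f x \<psi> = (y - x) * f' z \<psi>" using * by blast
    then show thesis using 1 by (intro that[of z]) (auto simp: algebra_simps)
  next
    case 2 then show thesis by (intro that[of x]) auto
  next
    case 3
    then obtain z where "y \<le> z" "z \<le> x" "f x \<psi> - f y \<psi> = (x - y) * f' z \<psi>" using * by blast
    then show thesis using 3 by (intro that[of z]) auto
  qed
qed

lemma f_lip: "\<bar>f x \<psi> - f y \<psi>\<bar> \<le> \<bar>x - y\<bar>"
proof -
  obtain z where z: "f x \<psi> - f y \<psi> = (x - y) * f' z \<psi>" by (rule f_mvt)
  show ?thesis unfolding z abs_mult using f'_le[of z \<psi>] by (simp add: mult_left_le)
qed

text \<open>The mean value inequality in x for f x y - f x y', whose derivative is small by Hoelder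
  continuity of f'.\<close>

lemma f_double_diff:
  "\<bar>(f x y - f x' y) - (f x y' - f x' y')\<bar> \<le> H * norm (y - y') powr \<alpha> * \<bar>x - x'\<bar>"
proof -
  have "norm ((f x y - f x y') - (f x' y - f x' y')) \<le> H * norm (y - y') powr \<alpha> * norm (x - x')"
  proof (rule field_differentiable_bound[of UNIV _ "\<lambda>x. f' x y - f' x y'"])
    show "((\<lambda>x. f x y - f x y') has_field_derivative f' z y - f' z y') (at z within UNIV)" for z
      by (intro derivative_intros f_deriv)
    show "norm (f' z y - f' z y') \<le> H * norm (y - y') powr \<alpha>" for z
      using f'_holder[of z y y'] by simp
  qed auto
  then show ?thesis by (simp add: algebra_simps)
qed

lemma continuous_f: "continuous_on UNIV (\<lambda>(\<phi>, \<psi>). f \<phi> \<psi>)"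
  by (rule continuous_on_lipschitz_holder[OF _ f_holder \<alpha>(1), where K = 1]) (simp add: f_lip)

lemma continuous_f': "continuous_on UNIV (\<lambda>(\<phi>, \<psi>). f' \<phi> \<psi>)"
  by (rule continuous_on_lipschitz_holder[OF _ f'_holder \<alpha>(1), where K = 1]) (simp add: f'_lip)

lemma continuous_on_f [continuous_intros]:
  "continuous_on S p \<Longrightarrow> continuous_on S q \<Longrightarrow> continuous_on S (\<lambda>z. f (p z) (q z))"
  by (rule continuous_on_compose_curried[OF continuous_f])

text \<open>The fibre map has derivative 1 + \<rho> * f', which lies between 0 and 1 - \<rho> *
  \<gamma>: the lower bound comes from \<rho> < 1 and |f'| \<le> 1, the upper from the decrease of f
  on {a..b}.\<close>

lemma step_diff:
  assumes \<rho>: "0 < \<rho>" "\<rho> < 1" and xy: "x \<in> {a..b}" "y \<in> {a..b}" "x \<le> y"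
  shows "x + \<rho> * f x \<psi> \<le> y + \<rho> * f y \<psi>"
    and "(y + \<rho> * f y \<psi>) - (x + \<rho> * f x \<psi>) \<le> (1 - \<rho> * \<gamma>) * (y - x)"
proof -
  obtain z where z: "min y x \<le> z" "z \<le> max y x" "f y \<psi> - f x \<psi> = (y - x) * f' z \<psi>"
    by (rule f_mvt)
  have *: "(y + \<rho> * f y \<psi>) - (x + \<rho> * f x \<psi>) = (1 + \<rho> * f' z \<psi>) * (y - x)"
  proof -
    have "(y + \<rho> * f y \<psi>) - (x + \<rho> * f x \<psi>) = (y - x) + \<rho> * (f y \<psi> - f x \<psi>)"
      by (simp add: algebra_simps)
    then show ?thesis unfolding z(3) by (simp add: algebra_simps)
  qed
  have "f' z \<psi> \<le> - \<gamma>" using z(1,2) xy by (intro f'_neg) auto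
  then have u: "\<rho> * f' z \<psi> \<le> \<rho> * - \<gamma>" using \<rho> by (intro mult_left_mono) auto
  have l: "\<rho> * -1 \<le> \<rho> * f' z \<psi>" using \<rho> f'_le[of z \<psi>] by (intro mult_left_mono) auto
  show "(y + \<rho> * f y \<psi>) - (x + \<rho> * f x \<psi>) \<le> (1 - \<rho> * \<gamma>) * (y - x)"
    unfolding * using u xy by (intro mult_right_mono) auto
  have "0 \<le> (1 + \<rho> * f' z \<psi>) * (y - x)" using l xy \<rho> by (intro mult_nonneg_nonneg) auto
  then show "x + \<rho> * f x \<psi> \<le> y + \<rho> * f y \<psi>" using * by linarith
qed

lemma step_contract:
  assumes \<rho>: "0 < \<rho>" "\<rho> < 1" and xy: "x \<in> {a..b}" "y \<in> {a..b}"
  shows "\<bar>(x + \<rho> * f x \<psi>) - (y + \<rho> * f y \<psi>)\<bar> \<le> (1 - \<rho> * \<gamma>) * \<bar>x - y\<bar>"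
proof (cases "x \<le> y")
  case True
  then have *: "\<bar>x - y\<bar> = y - x" by simp
  show ?thesis using step_diff[OF \<rho> xy True, of \<psi>] unfolding * abs_le_iff by linarith
next
  case False
  then have *: "y \<le> x" "\<bar>x - y\<bar> = x - y" by simp_all
  show ?thesis using step_diff[OF \<rho> xy(2,1) *(1), of \<psi>] unfolding *(2) abs_le_iff by linarith
qed

lemma step_range:
  assumes \<rho>: "0 < \<rho>" "\<rho> < 1" and x: "x \<in> {a..b}"
  shows "x + \<rho> * f x \<psi> \<in> {a..b}"
proof -
  have "a + \<rho> * f a \<psi> \<le> x + \<rho> * f x \<psi>" "x + \<rho> * f x \<psi> \<le> b + \<rho> * f b \<psi>"
    using x by (auto intro!: step_diff(1) \<rho>)
  moreover have "0 \<le> \<rho> * f a \<psi>" "\<rho> * f b \<psi> \<le> 0"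
    using \<rho> f_a f_b by (auto intro: mult_nonneg_nonpos)
  ultimately show ?thesis by auto
qed

lemma contraction_rate:
  assumes "0 < \<rho>" "\<rho> < 1"
  shows "0 \<le> 1 - \<rho> * \<gamma>" "1 - \<rho> * \<gamma> < 1"
proof -
  have "\<gamma> \<le> 1" using f'_neg[OF ab, of 0] f'_le[of 0 0] by linarith
  then show "0 \<le> 1 - \<rho> * \<gamma>" using assms \<gamma>_pos by (simp add: mult_le_one)
  show "1 - \<rho> * \<gamma> < 1" using assms \<gamma>_pos by simp
qed

section \<open>Uniqueness and construction of the invariant function\<close>

definition invariant_function :: "real \<Rightarrow> (real^2 \<Rightarrow> real) \<Rightarrow> bool" where
  "invariant_function \<rho> W \<longleftrightarrow> periodic_T2 W \<and> (\<forall>\<psi>. W \<psi> \<in> {a..b}) \<and>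
     (\<forall>\<psi>. W (A *v \<psi>) = W \<psi> + \<rho> * f (W \<psi>) \<psi>)"

lemma A_B [simp]: "A *v (B *v \<psi>) = \<psi>" and B_A [simp]: "B *v (A *v \<psi>) = \<psi>"
  by (simp_all add: matrix_vector_mul_assoc AB BA)

text \<open>Two invariant functions differ by at most b - a at the n-th preimage of \<psi>, and n
  forward steps contract this by q^n.\<close>

lemma invariant_function_unique:
  assumes \<rho>: "0 < \<rho>" "\<rho> < 1" and W: "invariant_function \<rho> W" "invariant_function \<rho> V"
  shows "W = V"
proof
  fix \<psi>
  define q where "q = 1 - \<rho> * \<gamma>"
  have q: "0 \<le> q" "q < 1" using contraction_rate[OF \<rho>] by (auto simp: q_def)
  have "\<bar>W \<psi> - V \<psi>\<bar> \<le> q ^ n * (b - a)" for n \<psi>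
  proof (induction n arbitrary: \<psi>)
    case 0
    have "W \<psi> \<in> {a..b}" "V \<psi> \<in> {a..b}" using W by (auto simp: invariant_function_def)
    then show ?case by (auto simp: abs_if)
  next
    case (Suc n)
    let ?\<eta> = "B *v \<psi>"
    have "W \<psi> = W ?\<eta> + \<rho> * f (W ?\<eta>) ?\<eta>" "V \<psi> = V ?\<eta> + \<rho> * f (V ?\<eta>) ?\<eta>"
      and "W ?\<eta> \<in> {a..b}" "V ?\<eta> \<in> {a..b}"
      using W unfolding invariant_function_def by (metis A_B)+
    then have "\<bar>W \<psi> - V \<psi>\<bar> \<le> q * \<bar>W ?\<eta> - V ?\<eta>\<bar>"
      using step_contract[OF \<rho>, of "W ?\<eta>" "V ?\<eta>" ?\<eta>] by (simp add: q_def)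
    also have "\<dots> \<le> q * (q ^ n * (b - a))" by (intro mult_left_mono Suc q)
    finally show ?case by simp
  qed
  moreover have "(\<lambda>n. q ^ n * (b - a)) \<longlonglongrightarrow> 0 * (b - a)"
    using q by (intro tendsto_intros LIMSEQ_realpow_zero)
  ultimately have "\<bar>W \<psi> - V \<psi>\<bar> \<le> 0 * (b - a)"
    by (intro LIMSEQ_le_const) auto
  then show "W \<psi> = V \<psi>" by simp
qed

text \<open>The graph transform applied repeatedly to the zero section, which lies in the strip
  because 0 belongs to {a..b}.\<close>

primrec graph_iter :: "real \<Rightarrow> nat \<Rightarrow> real^2 \<Rightarrow> real" where
  "graph_iter \<rho> 0 = (\<lambda>\<psi>. 0)"
| "graph_iter \<rho> (Suc n) = (\<lambda>\<psi>. graph_iter \<rho> n (B *v \<psi>) + \<rho> * f (graph_iter \<rho> n (B *v \<psi>)) (B *v \<psi>))"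

lemma invariant_function_exists:
  assumes \<rho>: "0 < \<rho>" "\<rho> < 1"
  obtains W where "invariant_function \<rho> W" "continuous_on UNIV W"
proof -
  define q where "q = 1 - \<rho> * \<gamma>"
  have q: "0 \<le> q" "q < 1" using contraction_rate[OF \<rho>] by (auto simp: q_def)
  let ?W = "graph_iter \<rho>"
  have range: "?W n \<psi> \<in> {a..b}" for n \<psi>
    using ab by (induction n arbitrary: \<psi>) (auto simp del: atLeastAtMost_iff intro!: step_range \<rho>)
  have cont: "continuous_on UNIV (?W n)" for n
  proof (induction n)
    case (Suc n)
    have "continuous_on UNIV (\<lambda>\<psi>. ?W n (B *v \<psi>))"
      by (rule continuous_on_compose2[OF Suc]) (auto intro!: continuous_intros)
    then show ?case unfolding graph_iter.simps by (intro continuous_intros)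
  qed auto
  have per: "periodic_T2 (?W n)" for n
  proof (induction n)
    case (Suc n)
    have "periodic_T2 (\<lambda>\<psi>. ?W n \<psi> + \<rho> * f (?W n \<psi>) \<psi>)"
      using Suc f_periodic by (simp add: periodic_T2_def)
    from periodic_T2_int_matrix[OF int_B this] show ?case by simp
  qed (simp add: periodic_T2_def)
  have diff: "\<bar>?W (Suc n) \<psi> - ?W n \<psi>\<bar> \<le> q ^ n * (b - a)" for n \<psi>
  proof (induction n arbitrary: \<psi>)
    case 0
    show ?case using range[of "Suc 0" \<psi>] ab by auto
  next
    case (Suc n)
    have "\<bar>?W (Suc (Suc n)) \<psi> - ?W (Suc n) \<psi>\<bar> \<le> q * \<bar>?W (Suc n) (B *v \<psi>) - ?W n (B *v \<psi>)\<bar>"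
      using step_contract[OF \<rho> range[of "Suc n" "B *v \<psi>"] range[of n "B *v \<psi>"], of "B *v \<psi>"]
      by (simp add: q_def)
    also have "\<dots> \<le> q * (q ^ n * (b - a))" by (intro mult_left_mono Suc q)
    finally show ?case by simp
  qed
  define W where "W = (\<lambda>\<psi>. \<Sum>n. ?W (Suc n) \<psi> - ?W n \<psi>)"
  have "uniform_limit UNIV (\<lambda>n \<psi>. \<Sum>i<n. ?W (Suc i) \<psi> - ?W i \<psi>) W sequentially"
    unfolding W_def
  proof (rule Weierstrass_m_test)
    show "summable (\<lambda>n. q ^ n * (b - a))" using q by (intro summable_mult2 summable_geometric) auto
    show "norm (?W (Suc n) \<psi> - ?W n \<psi>) \<le> q ^ n * (b - a)" for n \<psi>
      using diff[of n \<psi>] by (simp only: real_norm_def)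
  qed
  moreover have "(\<Sum>i<n. ?W (Suc i) \<psi> - ?W i \<psi>) = ?W n \<psi>" for n \<psi>
    using sum_lessThan_telescope[of "\<lambda>i. ?W i \<psi>" n] by simp
  ultimately have ulim: "uniform_limit UNIV ?W W sequentially" by simp
  then have lim: "(\<lambda>n. ?W n \<psi>) \<longlonglongrightarrow> W \<psi>" for \<psi>
    by (rule tendsto_uniform_limitI) simp
  have contW: "continuous_on UNIV W"
    by (rule uniform_limit_theorem[OF _ ulim]) (auto intro: always_eventually cont)
  have "invariant_function \<rho> W"
    unfolding invariant_function_def
  proof (intro conjI allI)
    show "periodic_T2 W"
      unfolding periodic_T2_def
    proof (intro allI)
      fix \<psi> i
      have "(\<lambda>n. ?W n \<psi>) \<longlonglongrightarrow> W (\<psi> + axis i (2 * pi))"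
        using lim[of "\<psi> + axis i (2 * pi)"] per by (simp add: periodic_T2_def)
      then show "W (\<psi> + axis i (2 * pi)) = W \<psi>" by (rule LIMSEQ_unique[OF _ lim])
    qed
    show "W \<psi> \<in> {a..b}" for \<psi>
      by (rule closed_sequentially[OF closed_atLeastAtMost range lim])
    show "W (A *v \<psi>) = W \<psi> + \<rho> * f (W \<psi>) \<psi>" for \<psi>
    proof (rule LIMSEQ_unique)
      show "(\<lambda>n. ?W (Suc n) (A *v \<psi>)) \<longlonglongrightarrow> W (A *v \<psi>)" by (rule LIMSEQ_Suc[OF lim])
      have "isCont (\<lambda>x. f x \<psi>) (W \<psi>)" using DERIV_isCont[OF f_deriv] .
      then have "(\<lambda>n. f (?W n \<psi>) \<psi>) \<longlonglongrightarrow> f (W \<psi>) \<psi>" by (rule isCont_tendsto_compose[OF _ lim])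
      then show "(\<lambda>n. ?W (Suc n) (A *v \<psi>)) \<longlonglongrightarrow> W \<psi> + \<rho> * f (W \<psi>) \<psi>"
        by (auto intro!: tendsto_intros lim)
    qed
  qed
  then show thesis using contW by (rule that)
qed

lemma ex1_invariant_function:
  assumes \<rho>: "0 < \<rho>" "\<rho> < 1"
  shows "\<exists>!W. invariant_function \<rho> W"
proof -
  obtain W where "invariant_function \<rho> W" by (rule invariant_function_exists[OF \<rho>])
  then show ?thesis using invariant_function_unique[OF \<rho>] by (intro ex1I[of _ W]) auto
qed

text \<open>Continuity is not built into \<open>invariant_function\<close>: it is inherited, through
  uniqueness, from the uniform limit of the graph transform.\<close>

lemma invariant_function_continuous:
  assumes \<rho>: "0 < \<rho>" "\<rho> < 1" and W: "invariant_function \<rho> W"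
  shows "continuous_on UNIV W"
proof -
  obtain V where "invariant_function \<rho> V" "continuous_on UNIV V" by (rule invariant_function_exists[OF \<rho>])
  then show ?thesis using invariant_function_unique[OF \<rho> W] by simp
qed

text \<open>A geometric series over the past: each backward step multiplies the Hoelder difference
  of f along \<open>eu\<close> by \<bar>\<mu>\<bar> powr \<alpha>. No negative power of \<rho>
  appears.\<close>

definition unstable_const :: real where
  "unstable_const = H * norm eu powr \<alpha> / (1 - \<bar>\<mu>\<bar> powr \<alpha>)"

lemma mu_powr: "0 < \<bar>\<mu>\<bar> powr \<alpha>" "\<bar>\<mu>\<bar> powr \<alpha> < 1"
  using mu_pos mu_less_1 \<alpha> powr_less_mono2[of \<alpha> "\<bar>\<mu>\<bar>" 1] by auto

lemma unstable_const_nonneg: "0 \<le> unstable_const"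
  using mu_powr H_nonneg by (simp add: unstable_const_def)

text \<open>Backward iteration contracts the expanding direction, so that the value of \<open>W\<close> depends on
  the base point along this direction only through the factor \<open>\<rho>\<close> in front of \<open>f\<close>.\<close>

lemma invariant_function_unstable:
  assumes \<rho>: "0 < \<rho>" "\<rho> < 1" and W: "invariant_function \<rho> W"
  shows "\<bar>W (\<psi> + t *\<^sub>R eu) - W \<psi>\<bar> \<le> \<rho> * unstable_const * \<bar>t\<bar> powr \<alpha>"
proof -
  define q where "q = 1 - \<rho> * \<gamma>"
  have q: "0 \<le> q" "q < 1" using contraction_rate[OF \<rho>] by (auto simp: q_def)
  define p where "p = \<bar>\<mu>\<bar> powr \<alpha>"
  have p: "0 < p" "p < 1" using mu_powr by (auto simp: p_def)
  define h where "h = H * norm eu powr \<alpha>"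
  have h: "0 \<le> h" using H_nonneg by (simp add: h_def)
  have C: "unstable_const = h / (1 - p)" by (simp add: unstable_const_def h_def p_def)
  have inv: "W (A *v \<psi>) = W \<psi> + \<rho> * f (W \<psi>) \<psi>" and range: "W \<psi> \<in> {a..b}" for \<psi>
    using W unfolding invariant_function_def by blast+
  \<comment> \<open>No Hoelder bound for W is available to start from, so the induction carries the
    trivial bound b - a as an extra term, which decays under fibre contraction and vanishes in the
    limit.\<close>
  have "\<bar>W (\<psi> + t *\<^sub>R eu) - W \<psi>\<bar> \<le> q ^ n * (b - a) + \<rho> * unstable_const * \<bar>t\<bar> powr \<alpha>" for n \<psi> t
  proof (induction n arbitrary: \<psi> t)
    case 0
    have "\<bar>W (\<psi> + t *\<^sub>R eu) - W \<psi>\<bar> \<le> b - a"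
      using range[of \<psi>] range[of "\<psi> + t *\<^sub>R eu"] by (auto simp: abs_if)
    moreover have "0 \<le> \<rho> * unstable_const * \<bar>t\<bar> powr \<alpha>" using unstable_const_nonneg \<rho> by simp
    ultimately show ?case by simp
  next
    case (Suc n)
    define \<eta> where "\<eta> = B *v \<psi>"
    define \<eta>' where "\<eta>' = \<eta> + (t / \<nu>) *\<^sub>R eu"
    have "\<nu> \<noteq> 0" using nu_gt_1 by auto
    have e1: "W \<psi> = W \<eta> + \<rho> * f (W \<eta>) \<eta>" using inv[of \<eta>] by (simp add: \<eta>_def)
    have "A *v \<eta>' = \<psi> + t *\<^sub>R eu"
      using \<open>\<nu> \<noteq> 0\<close> by (simp add: \<eta>'_def \<eta>_def matrix_vector_right_distrib matrix_vector_mult_scaleR A_eu)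
    then have e2: "W (\<psi> + t *\<^sub>R eu) = W \<eta>' + \<rho> * f (W \<eta>') \<eta>'" using inv[of \<eta>'] by simp
    have tn: "\<bar>t / \<nu>\<bar> powr \<alpha> = p * \<bar>t\<bar> powr \<alpha>"
      using mu_pos by (simp add: abs_divide nu_eq p_def powr_mult mult.commute)
    \<comment> \<open>The increment is split: first the fibre coordinate changes over the same base
      point \<eta>', then the base point changes at fixed fibre coordinate W \<eta>.\<close>
    have s1: "\<bar>(W \<eta>' + \<rho> * f (W \<eta>') \<eta>') - (W \<eta> + \<rho> * f (W \<eta>) \<eta>')\<bar> \<le> q * \<bar>W \<eta>' - W \<eta>\<bar>"
      unfolding q_def by (rule step_contract[OF \<rho> range range])
    have "\<bar>f (W \<eta>) \<eta>' - f (W \<eta>) \<eta>\<bar> \<le> H * norm ((t / \<nu>) *\<^sub>R eu) powr \<alpha>"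
      using f_holder[of "W \<eta>" \<eta>' \<eta>] by (simp add: \<eta>'_def)
    also have "norm ((t / \<nu>) *\<^sub>R eu) powr \<alpha> = \<bar>t / \<nu>\<bar> powr \<alpha> * norm eu powr \<alpha>"
      unfolding norm_scaleR by (rule powr_mult)
    finally have "\<bar>f (W \<eta>) \<eta>' - f (W \<eta>) \<eta>\<bar> \<le> p * h * \<bar>t\<bar> powr \<alpha>"
      unfolding tn by (simp add: h_def mult_ac)
    then have "\<rho> * \<bar>f (W \<eta>) \<eta>' - f (W \<eta>) \<eta>\<bar> \<le> \<rho> * (p * h * \<bar>t\<bar> powr \<alpha>)"
      using \<rho> by (intro mult_left_mono) auto
    moreover have "\<rho> * \<bar>f (W \<eta>) \<eta>' - f (W \<eta>) \<eta>\<bar>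
        = \<bar>(W \<eta> + \<rho> * f (W \<eta>) \<eta>') - (W \<eta> + \<rho> * f (W \<eta>) \<eta>)\<bar>"
      using \<rho> by (simp add: abs_mult flip: right_diff_distrib)
    moreover have "q * \<bar>W \<eta>' - W \<eta>\<bar> \<le> q ^ Suc n * (b - a) + \<rho> * unstable_const * (p * \<bar>t\<bar> powr \<alpha>)"
    proof -
      have "q * \<bar>W \<eta>' - W \<eta>\<bar> \<le> q * (q ^ n * (b - a) + \<rho> * unstable_const * \<bar>t / \<nu>\<bar> powr \<alpha>)"
        using Suc[of \<eta> "t / \<nu>"] by (intro mult_left_mono q) (simp add: \<eta>'_def)
      also have "\<dots> = q ^ Suc n * (b - a) + q * (\<rho> * unstable_const * (p * \<bar>t\<bar> powr \<alpha>))"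
        unfolding tn by (simp add: algebra_simps)
      \<comment> \<open>Here q is simply bounded by 1: summability rests on p alone, since using q
        instead would cost 1 / (\<rho> * \<gamma>).\<close>
      also have "q * (\<rho> * unstable_const * (p * \<bar>t\<bar> powr \<alpha>)) \<le> \<rho> * unstable_const * (p * \<bar>t\<bar> powr \<alpha>)"
        using q p \<rho> unstable_const_nonneg by (intro mult_left_le_one_le) auto
      finally show ?thesis by simp
    qed
    moreover have "\<rho> * (p * (unstable_const + h)) * \<bar>t\<bar> powr \<alpha>
        = \<rho> * unstable_const * (p * \<bar>t\<bar> powr \<alpha>) + \<rho> * (p * h * \<bar>t\<bar> powr \<alpha>)"
      by (simp add: algebra_simps)
    moreover note s1
    ultimately have "\<bar>W (\<psi> + t *\<^sub>R eu) - W \<psi>\<bar>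
        \<le> q ^ Suc n * (b - a) + \<rho> * (p * (unstable_const + h)) * \<bar>t\<bar> powr \<alpha>"
      unfolding e1 e2 by linarith
    \<comment> \<open>As \<open>unstable_const\<close> is h / (1 - p), the claim reduces to p * (2 -
      p) \<le> 1, that is, (1 - p)^2 \<ge> 0.\<close>
    also have "p * (unstable_const + h) \<le> unstable_const"
    proof -
      have "0 \<le> (1 - p)\<^sup>2" by simp
      then have "p * (2 - p) \<le> 1" by (simp add: power2_eq_square algebra_simps)
      then have "h * (p * (2 - p)) / (1 - p) \<le> h * 1 / (1 - p)"
        using h p by (intro divide_right_mono mult_left_mono) auto
      moreover have "p * (unstable_const + h) = h * (p * (2 - p)) / (1 - p)"
        using p by (simp add: C field_simps)
      ultimately show ?thesis by (simp add: C)
    qed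
    then have "\<rho> * (p * (unstable_const + h)) * \<bar>t\<bar> powr \<alpha> \<le> \<rho> * unstable_const * \<bar>t\<bar> powr \<alpha>"
      using \<rho> by (intro mult_right_mono mult_left_mono) auto
    finally show ?case by simp
  qed
  then have "\<bar>W (\<psi> + t *\<^sub>R eu) - W \<psi>\<bar> - \<rho> * unstable_const * \<bar>t\<bar> powr \<alpha> \<le> q ^ n * (b - a)" for n
    by (simp add: algebra_simps)
  moreover have "(\<lambda>n. q ^ n * (b - a)) \<longlonglongrightarrow> 0 * (b - a)"
    using q by (intro tendsto_intros LIMSEQ_realpow_zero)
  ultimately have "\<bar>W (\<psi> + t *\<^sub>R eu) - W \<psi>\<bar> - \<rho> * unstable_const * \<bar>t\<bar> powr \<alpha> \<le> 0 * (b - a)"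
    by (intro LIMSEQ_le_const) auto
  then show ?thesis by simp
qed

end

section \<open>Averages along the invariant graph\<close>

context forced_skew_product
begin

text \<open>The last condition is the Hoelder continuity of \<open>\<partial>\<^sub>\<phi> g\<close>, stated without derivatives.\<close>

definition observable :: "real \<Rightarrow> (real \<Rightarrow> real^2 \<Rightarrow> real) \<Rightarrow> bool" where
  "observable K g \<longleftrightarrow> continuous_on UNIV (\<lambda>(\<phi>, y). g \<phi> y) \<and> (\<forall>\<phi>. periodic_T2 (g \<phi>)) \<and>
     (\<forall>\<phi>. torus_avg (g \<phi>) = 0) \<and>
     (\<forall>\<phi>\<in>{a..b}. \<forall>y. \<bar>g \<phi> y\<bar> \<le> K) \<and>
     (\<forall>\<phi>\<in>{a..b}. \<forall>y y'. \<bar>g \<phi> y' - g \<phi> y\<bar> \<le> K * norm (y' - y) powr \<alpha>) \<and>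
     (\<forall>x\<in>{a..b}. \<forall>x'\<in>{a..b}. \<forall>y. \<bar>g x y - g x' y\<bar> \<le> K * \<bar>x - x'\<bar>) \<and>
     (\<forall>x\<in>{a..b}. \<forall>x'\<in>{a..b}. \<forall>y y'. \<bar>(g x y' - g x' y') - (g x y - g x' y)\<bar>
        \<le> K * \<bar>x - x'\<bar> * norm (y' - y) powr \<alpha>)"

lemma powr_abs_mult: "\<bar>t * c\<bar> powr \<alpha> = \<bar>c\<bar> powr \<alpha> * \<bar>t\<bar> powr \<alpha>" for t c :: real
  by (simp add: abs_mult powr_mult mult.commute)

text \<open>The first bound has no factor \<rho> and serves only to show that the correlations tend
  to 0. The second has it in every norm: W moves by at most \<rho> under A, is O(\<rho>) Hoelder
  along \<open>eu\<close>, and mixed differences of g transfer this to the second variable.\<close>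

lemma observable_increment_unstable:
  assumes \<rho>: "0 < \<rho>" "\<rho> < 1" and W: "invariant_function \<rho> W" and g: "observable K g"
  shows "unstable_holder eu \<alpha> (K * (1 + unstable_const)) (\<lambda>\<psi>. g (W \<psi>))"
    and "unstable_holder eu \<alpha> (\<rho> * (K * (1 + unstable_const + unstable_const * \<bar>\<nu>\<bar> powr \<alpha>)))
      (\<lambda>\<psi> y. g (W (A *v \<psi>)) y - g (W \<psi>) y)"
proof -
  have inv: "W (A *v \<psi>) = W \<psi> + \<rho> * f (W \<psi>) \<psi>" and range: "W \<psi> \<in> {a..b}"
    and perW: "periodic_T2 W" for \<psi>
    using W unfolding invariant_function_def by blast+
  have contW: "continuous_on UNIV W" by (rule invariant_function_continuous[OF \<rho> W])
  have perWA: "periodic_T2 (\<lambda>\<psi>. W (A *v \<psi>))" by (rule periodic_T2_A[OF perW])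
  have unst: "\<bar>W (\<psi> + t *\<^sub>R eu) - W \<psi>\<bar> \<le> \<rho> * unstable_const * \<bar>t\<bar> powr \<alpha>" for \<psi> t
    by (rule invariant_function_unstable[OF \<rho> W])
  have cont: "continuous_on UNIV (\<lambda>(\<phi>, y). g \<phi> y)" and per: "\<And>\<phi>. periodic_T2 (g \<phi>)"
    and zero: "\<And>\<phi>. torus_avg (g \<phi>) = 0"
    and g_le: "\<And>\<phi> y. \<phi> \<in> {a..b} \<Longrightarrow> \<bar>g \<phi> y\<bar> \<le> K"
    and g_hold: "\<And>\<phi> y y'. \<phi> \<in> {a..b} \<Longrightarrow> \<bar>g \<phi> y' - g \<phi> y\<bar> \<le> K * norm (y' - y) powr \<alpha>"
    and g_lip: "\<And>x x' y. x \<in> {a..b} \<Longrightarrow> x' \<in> {a..b} \<Longrightarrow> \<bar>g x y - g x' y\<bar> \<le> K * \<bar>x - x'\<bar>"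
    and g_dd: "\<And>x x' y y'. x \<in> {a..b} \<Longrightarrow> x' \<in> {a..b} \<Longrightarrow>
      \<bar>(g x y' - g x' y') - (g x y - g x' y)\<bar> \<le> K * \<bar>x - x'\<bar> * norm (y' - y) powr \<alpha>"
    using g unfolding observable_def by blast+
  have K0: "0 \<le> K" using g_le[OF ab, of 0] by linarith
  note C0 = unstable_const_nonneg
  have contWs: "continuous_on UNIV (\<lambda>(\<psi>, y). W \<psi>)" "continuous_on UNIV (\<lambda>(\<psi>, y). W (A *v \<psi>))"
    unfolding case_prod_beta by (auto intro!: continuous_on_compose2[OF contW] continuous_intros)
  have gW: "\<bar>g (W (\<psi> + t *\<^sub>R eu)) y - g (W \<psi>) y\<bar> \<le> \<rho> * (K * unstable_const * \<bar>t\<bar> powr \<alpha>)" for \<psi> t y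
  proof -
    have "\<bar>g (W (\<psi> + t *\<^sub>R eu)) y - g (W \<psi>) y\<bar> \<le> K * \<bar>W (\<psi> + t *\<^sub>R eu) - W \<psi>\<bar>"
      by (rule g_lip[OF range range])
    also have "\<dots> \<le> K * (\<rho> * unstable_const * \<bar>t\<bar> powr \<alpha>)" by (intro mult_left_mono unst K0)
    finally show ?thesis by (simp add: mult_ac)
  qed
  have c1: "continuous_on UNIV (\<lambda>(\<psi>, y). g (W \<psi>) y)"
    using continuous_on_compose_curried[OF cont contWs(1)[unfolded case_prod_beta] continuous_on_snd[OF continuous_on_id]]
    by (simp add: case_prod_beta)
  have c2: "continuous_on UNIV (\<lambda>(\<psi>, y). g (W (A *v \<psi>)) y)"
    using continuous_on_compose_curried[OF cont contWs(2)[unfolded case_prod_beta] continuous_on_snd[OF continuous_on_id]]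
    by (simp add: case_prod_beta)
  show "unstable_holder eu \<alpha> (K * (1 + unstable_const)) (\<lambda>\<psi>. g (W \<psi>))"
    unfolding unstable_holder_def
  proof (intro conjI allI)
    show "continuous_on UNIV (\<lambda>(\<psi>, y). g (W \<psi>) y)" by (rule c1)
    show "periodic_T2 (\<lambda>\<psi>. g (W \<psi>) y)" for y using perW by (simp add: periodic_T2_def)
    show "periodic_T2 (g (W \<psi>))" "torus_avg (g (W \<psi>)) = 0" for \<psi> by (rule per, rule zero)
    fix \<psi> y
    have K1: "K \<le> K * (1 + unstable_const)" using K0 C0 by (simp add: mult_le_cancel_left1)
    show "\<bar>g (W \<psi>) y\<bar> \<le> K * (1 + unstable_const)" using g_le[OF range] K1 by (rule order_trans)
    show "\<bar>g (W \<psi>) y' - g (W \<psi>) y\<bar> \<le> K * (1 + unstable_const) * norm (y' - y) powr \<alpha>" for y'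
      using g_hold[OF range] by (rule order_trans) (intro mult_right_mono K1, simp)
    show "\<bar>g (W (\<psi> + t *\<^sub>R eu)) y - g (W \<psi>) y\<bar> \<le> K * (1 + unstable_const) * \<bar>t\<bar> powr \<alpha>" for t
    proof -
      have "\<rho> * (K * unstable_const * \<bar>t\<bar> powr \<alpha>) \<le> K * unstable_const * \<bar>t\<bar> powr \<alpha>"
        using \<rho> K0 C0 by (intro mult_left_le_one_le) auto
      also have "\<dots> \<le> K * (1 + unstable_const) * \<bar>t\<bar> powr \<alpha>"
        using K0 by (intro mult_right_mono mult_left_mono) auto
      finally show ?thesis using gW[of \<psi> t y] by linarith
    qed
  qed
  let ?C = "1 + unstable_const + unstable_const * \<bar>\<nu>\<bar> powr \<alpha>"
  have C1: "1 \<le> ?C" using C0 by (simp add: add_nonneg_nonneg)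
  have WA: "\<bar>W (A *v \<psi>) - W \<psi>\<bar> \<le> \<rho>" for \<psi>
    using inv[of \<psi>] f_le[of "W \<psi>" \<psi>] \<rho> by (simp add: abs_mult)
  have KC: "K * \<rho> \<le> \<rho> * (K * ?C)"
    using C1 K0 \<rho> mult_left_mono[of 1 ?C "\<rho> * K"] by (simp add: mult_ac)
  show "unstable_holder eu \<alpha> (\<rho> * (K * ?C)) (\<lambda>\<psi> y. g (W (A *v \<psi>)) y - g (W \<psi>) y)"
    unfolding unstable_holder_def
  proof (intro conjI allI)
    show "continuous_on UNIV (\<lambda>(\<psi>, y). g (W (A *v \<psi>)) y - g (W \<psi>) y)"
      using continuous_on_diff[OF c2 c1] by (simp add: case_prod_beta)
    show "periodic_T2 (\<lambda>\<psi>. g (W (A *v \<psi>)) y - g (W \<psi>) y)" for y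
      using perW perWA by (simp add: periodic_T2_def)
    show "periodic_T2 (\<lambda>y. g (W (A *v \<psi>)) y - g (W \<psi>) y)" for \<psi>
      using per by (simp add: periodic_T2_def)
    show "torus_avg (\<lambda>y. g (W (A *v \<psi>)) y - g (W \<psi>) y) = 0" for \<psi>
      by (subst torus_avg_diff) (auto simp: zero intro: continuous_on_slice(1)[OF cont])
    fix \<psi> y
    show "\<bar>g (W (A *v \<psi>)) y - g (W \<psi>) y\<bar> \<le> \<rho> * (K * ?C)"
    proof -
      have "\<bar>g (W (A *v \<psi>)) y - g (W \<psi>) y\<bar> \<le> K * \<bar>W (A *v \<psi>) - W \<psi>\<bar>" by (rule g_lip[OF range range])
      also have "\<dots> \<le> K * \<rho>" by (intro mult_left_mono WA K0)
      finally show ?thesis using KC by linarith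
    qed
    show "\<bar>(g (W (A *v \<psi>)) y' - g (W \<psi>) y') - (g (W (A *v \<psi>)) y - g (W \<psi>) y)\<bar>
        \<le> \<rho> * (K * ?C) * norm (y' - y) powr \<alpha>" for y'
    proof -
      have "\<bar>(g (W (A *v \<psi>)) y' - g (W \<psi>) y') - (g (W (A *v \<psi>)) y - g (W \<psi>) y)\<bar>
          \<le> K * \<bar>W (A *v \<psi>) - W \<psi>\<bar> * norm (y' - y) powr \<alpha>" by (rule g_dd[OF range range])
      also have "\<dots> \<le> K * \<rho> * norm (y' - y) powr \<alpha>" by (intro mult_right_mono mult_left_mono WA K0) simp
      also have "\<dots> \<le> \<rho> * (K * ?C) * norm (y' - y) powr \<alpha>" by (intro mult_right_mono KC) simp
      finally show ?thesis .
    qed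
    show "\<bar>(g (W (A *v (\<psi> + t *\<^sub>R eu))) y - g (W (\<psi> + t *\<^sub>R eu)) y) - (g (W (A *v \<psi>)) y - g (W \<psi>) y)\<bar>
        \<le> \<rho> * (K * ?C) * \<bar>t\<bar> powr \<alpha>" for t
    proof -
      \<comment> \<open>A stretches the displacement by \<nu>, hence the term with \<bar>\<nu>\<bar>
        powr \<alpha> in the constant.\<close>
      have "A *v (\<psi> + t *\<^sub>R eu) = A *v \<psi> + (t * \<nu>) *\<^sub>R eu"
        by (simp add: matrix_vector_right_distrib matrix_vector_mult_scaleR A_eu)
      then have "\<bar>g (W (A *v (\<psi> + t *\<^sub>R eu))) y - g (W (A *v \<psi>)) y\<bar>
          \<le> \<rho> * (K * unstable_const * (\<bar>\<nu>\<bar> powr \<alpha> * \<bar>t\<bar> powr \<alpha>))"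
        using gW[of "A *v \<psi>" "t * \<nu>" y] by (simp add: powr_abs_mult)
      moreover have "\<rho> * (K * ?C) * \<bar>t\<bar> powr \<alpha> = \<rho> * (K * unstable_const * (\<bar>\<nu>\<bar> powr \<alpha> * \<bar>t\<bar> powr \<alpha>))
          + \<rho> * (K * unstable_const * \<bar>t\<bar> powr \<alpha>) + \<rho> * K * \<bar>t\<bar> powr \<alpha>"
        by (simp add: algebra_simps)
      moreover have "0 \<le> \<rho> * K * \<bar>t\<bar> powr \<alpha>" using \<rho> K0 by simp
      ultimately show ?thesis using gW[of \<psi> t y] by linarith
    qed
  qed
qed

text \<open>With \<open>c n = \<langle>g(W(\<psi>), A\<^sup>n \<psi>)\<rangle>\<close>, invariance of the mean turns \<open>c n - c (n + 1)\<close> into a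
  correlation of the increment of \<open>g\<close> along \<open>W \<circ> A - W = O(\<rho>)\<close>; these correlations are summable.\<close>

lemma averaging_along_graph:
  obtains E where "0 \<le> E"
    "\<And>\<rho> W K g. 0 < \<rho> \<Longrightarrow> \<rho> < 1 \<Longrightarrow> invariant_function \<rho> W \<Longrightarrow> observable K g \<Longrightarrow>
       \<bar>torus_avg (\<lambda>\<psi>. g (W \<psi>) \<psi>)\<bar> \<le> \<rho> * (K * E)"
proof -
  obtain C \<theta> where C: "0 \<le> C" and \<theta>: "0 < \<theta>" "\<theta> < 1"
    and dec: "\<And>K G n. unstable_holder eu \<alpha> K G \<Longrightarrow> \<bar>torus_avg (\<lambda>\<psi>. G \<psi> (T n \<psi>))\<bar> \<le> K * C * \<theta> ^ n"
    using decay_of_correlations[OF \<alpha>] by blast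
  define D where "D = 1 + unstable_const + unstable_const * \<bar>\<nu>\<bar> powr \<alpha>"
  have D0: "0 \<le> D" using unstable_const_nonneg by (simp add: D_def add_nonneg_nonneg)
  show thesis
  proof
    show "0 \<le> D * C / (1 - \<theta>)" using D0 C \<theta> by simp
    fix \<rho> W K g
    assume \<rho>: "0 < \<rho>" "\<rho> < 1" and W: "invariant_function \<rho> W" and g: "observable K g"
    note uh = observable_increment_unstable[OF \<rho> W g, folded D_def]
    have K0: "0 \<le> K" using g ab unfolding observable_def by (meson abs_ge_zero order_trans)
    have contW: "continuous_on UNIV W" by (rule invariant_function_continuous[OF \<rho> W])
    have perW: "periodic_T2 W" using W by (simp add: invariant_function_def)
    have cont: "continuous_on UNIV (\<lambda>(\<phi>, y). g \<phi> y)" and per: "\<And>\<phi>. periodic_T2 (g \<phi>)"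
      using g by (auto simp: observable_def)
    define c where "c = (\<lambda>n. torus_avg (\<lambda>\<psi>. g (W \<psi>) (T n \<psi>)))"
    have cont_c: "continuous_on UNIV (\<lambda>\<psi>. g (W (T m \<psi>)) (T n \<psi>))" for m n
      by (intro continuous_on_compose_curried[OF cont] continuous_on_compose2[OF contW] continuous_intros) auto
    have cdiff: "\<bar>c n - c (Suc n)\<bar> \<le> \<rho> * (K * D) * C * \<theta> ^ Suc n" for n
    proof -
      have p: "periodic_T2 (\<lambda>\<psi>. g (W \<psi>) (T n \<psi>))"
        using periodic_T2_T[OF per] perW unfolding periodic_T2_def by metis
      have "c n = torus_avg (\<lambda>\<psi>. g (W (A *v \<psi>)) (T n (A *v \<psi>)))"
        unfolding c_def by (rule torus_avg_A[OF _ p, symmetric]) (use cont_c[of 0 n] in simp)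
      also have "\<dots> = torus_avg (\<lambda>\<psi>. g (W (A *v \<psi>)) (T (Suc n) \<psi>))"
        by (simp add: funpow_swap1)
      finally have "c n - c (Suc n) = torus_avg (\<lambda>\<psi>. g (W (A *v \<psi>)) (T (Suc n) \<psi>) - g (W \<psi>) (T (Suc n) \<psi>))"
        unfolding c_def using torus_avg_diff[OF cont_c[of 1 "Suc n"] cont_c[of 0 "Suc n"]] by simp
      then show ?thesis using dec[OF uh(2), of "Suc n"] by simp
    qed
    \<comment> \<open>Telescoping up to n gives a geometric sum of O(\<rho>) terms plus c n. The
      last term lacks the factor \<rho>, but n is free and it disappears as n grows.\<close>
    have bound: "\<bar>c 0\<bar> \<le> \<rho> * (K * (D * C / (1 - \<theta>))) + K * (1 + unstable_const) * C * \<theta> ^ n" for n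
    proof -
      have "c 0 = c n + (\<Sum>i<n. c i - c (Suc i))"
        by (induction n) simp_all
      moreover have "\<bar>\<Sum>i<n. c i - c (Suc i)\<bar> \<le> (\<Sum>i<n. \<rho> * (K * D) * C * \<theta> ^ i)"
      proof (rule order_trans[OF sum_abs sum_mono])
        fix i
        have "\<rho> * (K * D) * C * \<theta> ^ Suc i \<le> \<rho> * (K * D) * C * \<theta> ^ i"
          using \<rho> K0 D0 C \<theta> by (intro mult_left_mono power_decreasing) auto
        then show "\<bar>c i - c (Suc i)\<bar> \<le> \<rho> * (K * D) * C * \<theta> ^ i" using cdiff[of i] by linarith
      qed
      moreover have "(\<Sum>i<n. \<rho> * (K * D) * C * \<theta> ^ i) \<le> \<rho> * (K * D) * C * (1 / (1 - \<theta>))"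
      proof -
        have "(\<Sum>i<n. \<theta> ^ i) = (1 - \<theta> ^ n) / (1 - \<theta>)" using \<theta> by (simp add: sum_gp_strict)
        also have "\<dots> \<le> 1 / (1 - \<theta>)" using \<theta> by (intro divide_right_mono) auto
        finally show ?thesis
          unfolding sum_distrib_left[symmetric] using \<rho> K0 D0 C by (intro mult_left_mono) auto
      qed
      moreover have "\<rho> * (K * D) * C * (1 / (1 - \<theta>)) = \<rho> * (K * (D * C / (1 - \<theta>)))" by simp
      moreover have "\<bar>c n\<bar> \<le> K * (1 + unstable_const) * C * \<theta> ^ n"
        unfolding c_def by (rule dec[OF uh(1)])
      ultimately show ?thesis by linarith
    qed
    have "(\<lambda>n. \<rho> * (K * (D * C / (1 - \<theta>))) + K * (1 + unstable_const) * C * \<theta> ^ n)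
        \<longlonglongrightarrow> \<rho> * (K * (D * C / (1 - \<theta>))) + K * (1 + unstable_const) * C * 0"
      using \<theta> by (intro tendsto_intros LIMSEQ_realpow_zero) auto
    then have "\<bar>c 0\<bar> \<le> \<rho> * (K * (D * C / (1 - \<theta>))) + K * (1 + unstable_const) * C * 0"
      by (rule LIMSEQ_le_const) (use bound in auto)
    then show "\<bar>torus_avg (\<lambda>\<psi>. g (W \<psi>) \<psi>)\<bar> \<le> \<rho> * (K * (D * C / (1 - \<theta>)))"
      by (simp add: c_def)
  qed
qed

section \<open>The fluctuation of f about its mean, the averaged field, and the moments of W\<close>

lemma continuous_avg_f: "continuous_on UNIV (\<lambda>\<phi>. torus_avg (f \<phi>))"
  by (rule continuous_on_torus_avg[OF continuous_f])

lemma cont_f_slice: "continuous_on UNIV (f \<phi>)"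
  by (rule continuous_on_slice(1)[OF continuous_f])

lemma avg_f_le: "\<bar>torus_avg (f \<phi>)\<bar> \<le> 1"
  by (rule torus_avg_abs_le[OF cont_f_slice f_le])

lemma avg_f_lip: "\<bar>torus_avg (f x) - torus_avg (f y)\<bar> \<le> \<bar>x - y\<bar>"
  unfolding torus_avg_diff[OF cont_f_slice cont_f_slice, symmetric]
  by (rule torus_avg_abs_le) (auto intro!: continuous_intros cont_f_slice f_lip)

definition fluct :: "real \<Rightarrow> real^2 \<Rightarrow> real" where
  "fluct \<phi> \<psi> = f \<phi> \<psi> - torus_avg (f \<phi>)"

lemma continuous_fluct: "continuous_on UNIV (\<lambda>(\<phi>, \<psi>). fluct \<phi> \<psi>)"
  unfolding fluct_def case_prod_beta
  by (intro continuous_intros continuous_on_compose2[OF continuous_avg_f]) auto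

lemma fluct_avg: "torus_avg (fluct \<phi>) = 0"
  unfolding fluct_def by (subst torus_avg_diff) (auto intro: cont_f_slice)

lemma fluct_periodic: "periodic_T2 (fluct \<phi>)"
  using f_periodic by (simp add: fluct_def periodic_T2_def)

lemma fluct_le: "\<bar>fluct \<phi> \<psi>\<bar> \<le> 2"
  using f_le[of \<phi> \<psi>] avg_f_le[of \<phi>] unfolding fluct_def by linarith

lemma fluct_lip: "\<bar>fluct x \<psi> - fluct y \<psi>\<bar> \<le> 2 * \<bar>x - y\<bar>"
proof -
  have "fluct x \<psi> - fluct y \<psi> = (f x \<psi> - f y \<psi>) - (torus_avg (f x) - torus_avg (f y))"
    by (simp add: fluct_def)
  also have "\<bar>\<dots>\<bar> \<le> \<bar>f x \<psi> - f y \<psi>\<bar> + \<bar>torus_avg (f x) - torus_avg (f y)\<bar>"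
    by (rule abs_triangle_ineq4)
  also have "\<dots> \<le> \<bar>x - y\<bar> + \<bar>x - y\<bar>" by (intro add_mono f_lip avg_f_lip)
  finally show ?thesis by simp
qed

lemma fluct_holder: "\<bar>fluct \<phi> \<psi>' - fluct \<phi> \<psi>\<bar> \<le> H * norm (\<psi>' - \<psi>) powr \<alpha>"
  using f_holder[of \<phi> \<psi>' \<psi>] by (simp add: fluct_def)

lemma fluct_double_diff:
  "\<bar>(fluct x y' - fluct x' y') - (fluct x y - fluct x' y)\<bar> \<le> H * \<bar>x - x'\<bar> * norm (y' - y) powr \<alpha>"
  using f_double_diff[of x y' x' y] by (simp add: fluct_def mult_ac)

lemma observable_fluct: "observable (2 + H) fluct"
  unfolding observable_def
proof (intro conjI allI ballI)
  fix x x' \<phi> :: real and y y' :: "real^2"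
  show "continuous_on UNIV (\<lambda>(\<phi>, y). fluct \<phi> y)" by (rule continuous_fluct)
  show "periodic_T2 (fluct \<phi>)" by (rule fluct_periodic)
  show "torus_avg (fluct \<phi>) = 0" by (rule fluct_avg)
  show "\<bar>fluct \<phi> y\<bar> \<le> 2 + H" using fluct_le[of \<phi> y] H_nonneg by linarith
  have "H * norm (y' - y) powr \<alpha> \<le> (2 + H) * norm (y' - y) powr \<alpha>"
    by (intro mult_right_mono) auto
  then show "\<bar>fluct \<phi> y' - fluct \<phi> y\<bar> \<le> (2 + H) * norm (y' - y) powr \<alpha>"
    using fluct_holder[of \<phi> y' y] by linarith
  have "2 * \<bar>x - x'\<bar> \<le> (2 + H) * \<bar>x - x'\<bar>"
    using H_nonneg by (intro mult_right_mono) auto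
  then show "\<bar>fluct x y - fluct x' y\<bar> \<le> (2 + H) * \<bar>x - x'\<bar>"
    using fluct_lip[of x y x'] by linarith
  have "H * \<bar>x - x'\<bar> * norm (y' - y) powr \<alpha> \<le> (2 + H) * \<bar>x - x'\<bar> * norm (y' - y) powr \<alpha>"
    by (intro mult_right_mono) auto
  then show "\<bar>(fluct x y' - fluct x' y') - (fluct x y - fluct x' y)\<bar>
      \<le> (2 + H) * \<bar>x - x'\<bar> * norm (y' - y) powr \<alpha>"
    using fluct_double_diff[of x y' x' y] by linarith
qed

text \<open>The observable for the second moment. Since 0 lies in {a..b}, |\<phi>| is at most b - a;
  the extra 1 in the constant is the Lipschitz constant of the factor \<phi>.\<close>

lemma observable_mult_fluct: "observable ((b - a + 1) * (2 + H)) (\<lambda>\<phi> \<psi>. \<phi> * fluct \<phi> \<psi>)"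
  unfolding observable_def
proof (intro conjI allI ballI)
  let ?M = "b - a"
  have M: "0 \<le> ?M" "\<bar>x\<bar> \<le> ?M" if "x \<in> {a..b}" for x using that ab by auto
  have M0: "0 \<le> ?M" using ab by auto
  have H2: "0 \<le> 2 + H" using H_nonneg by simp
  show "continuous_on UNIV (\<lambda>(\<phi>, y). \<phi> * fluct \<phi> y)"
    using continuous_on_mult[OF continuous_on_fst[OF continuous_on_id] continuous_fluct[unfolded case_prod_beta]]
    by (simp add: case_prod_beta)
  show "periodic_T2 (\<lambda>\<psi>. \<phi> * fluct \<phi> \<psi>)" for \<phi> using fluct_periodic by (simp add: periodic_T2_def)
  show "torus_avg (\<lambda>\<psi>. \<phi> * fluct \<phi> \<psi>) = 0" for \<phi> by (simp add: torus_avg_cmult fluct_avg)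
  fix y y' :: "real^2"
  fix x assume x: "x \<in> {a..b}"
  have "\<bar>x * fluct x y\<bar> \<le> ?M * (2 + H)"
    unfolding abs_mult using fluct_le[of x y] H_nonneg M[OF x] by (intro mult_mono) auto
  also have "\<dots> \<le> (?M + 1) * (2 + H)" using H2 by (intro mult_right_mono) auto
  finally show "\<bar>x * fluct x y\<bar> \<le> (?M + 1) * (2 + H)" .
  define N where "N = norm (y' - y) powr \<alpha>"
  have N0: "0 \<le> N" by (simp add: N_def)
  have h: "\<bar>fluct x y' - fluct x y\<bar> \<le> (2 + H) * N" for x
  proof -
    have "H * N \<le> (2 + H) * N" using N0 by (intro mult_right_mono) auto
    then show ?thesis using fluct_holder[of x y' y] by (simp add: N_def)
  qed
  have "\<bar>x * fluct x y' - x * fluct x y\<bar> \<le> ?M * ((2 + H) * N)"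
    unfolding right_diff_distrib[symmetric] abs_mult using M[OF x] h by (intro mult_mono) auto
  also have "\<dots> \<le> (?M + 1) * ((2 + H) * N)" using H2 N0 by (intro mult_right_mono) auto
  finally show "\<bar>x * fluct x y' - x * fluct x y\<bar> \<le> (?M + 1) * (2 + H) * norm (y' - y) powr \<alpha>"
    by (simp add: N_def mult_ac)
  fix x' assume x': "x' \<in> {a..b}"
  have "\<bar>x * (fluct x y - fluct x' y)\<bar> \<le> ?M * ((2 + H) * \<bar>x - x'\<bar>)"
  proof -
    have "2 * \<bar>x - x'\<bar> \<le> (2 + H) * \<bar>x - x'\<bar>" using H_nonneg by (intro mult_right_mono) auto
    then show ?thesis
      unfolding abs_mult using M[OF x] fluct_lip[of x y x'] by (intro mult_mono) auto
  qed
  moreover have "\<bar>(x - x') * fluct x' y\<bar> \<le> \<bar>x - x'\<bar> * (2 + H)"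
    unfolding abs_mult using fluct_le[of x' y] H_nonneg by (intro mult_left_mono) auto
  moreover have "x * fluct x y - x' * fluct x' y = x * (fluct x y - fluct x' y) + (x - x') * fluct x' y"
    by (simp add: algebra_simps)
  moreover have "(?M + 1) * (2 + H) * \<bar>x - x'\<bar> = ?M * ((2 + H) * \<bar>x - x'\<bar>) + \<bar>x - x'\<bar> * (2 + H)"
    by (simp add: algebra_simps)
  ultimately show "\<bar>x * fluct x y - x' * fluct x' y\<bar> \<le> (?M + 1) * (2 + H) * \<bar>x - x'\<bar>" by linarith
  have "\<bar>x * ((fluct x y' - fluct x' y') - (fluct x y - fluct x' y))\<bar> \<le> ?M * ((2 + H) * \<bar>x - x'\<bar> * N)"
  proof -
    have "H * \<bar>x - x'\<bar> * N \<le> (2 + H) * \<bar>x - x'\<bar> * N" using N0 by (intro mult_right_mono) auto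
    then show ?thesis
      unfolding abs_mult using M[OF x] fluct_double_diff[of x y' x' y] by (intro mult_mono) (auto simp: N_def)
  qed
  moreover have "\<bar>(x - x') * (fluct x' y' - fluct x' y)\<bar> \<le> \<bar>x - x'\<bar> * ((2 + H) * N)"
    unfolding abs_mult using h by (intro mult_left_mono) auto
  moreover have "(x * fluct x y' - x' * fluct x' y') - (x * fluct x y - x' * fluct x' y)
      = x * ((fluct x y' - fluct x' y') - (fluct x y - fluct x' y)) + (x - x') * (fluct x' y' - fluct x' y)"
    by (simp add: algebra_simps)
  moreover have "(?M + 1) * (2 + H) * \<bar>x - x'\<bar> * N
      = ?M * ((2 + H) * \<bar>x - x'\<bar> * N) + \<bar>x - x'\<bar> * ((2 + H) * N)"
    by (simp add: algebra_simps)
  ultimately show "\<bar>(x * fluct x y' - x' * fluct x' y') - (x * fluct x y - x' * fluct x' y)\<bar>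
      \<le> (?M + 1) * (2 + H) * \<bar>x - x'\<bar> * norm (y' - y) powr \<alpha>"
    unfolding N_def[symmetric] by linarith
qed

text \<open>The segment from 0 to \<phi> stays in {a..b}, so f \<phi> - f 0 is \<phi> times a slope
  at most -\<gamma>. Multiplying by \<phi> makes the sign independent of that of \<phi>, and
  averaging removes f 0.\<close>

lemma avg_f_dissipative:
  assumes zero: "torus_avg (f 0) = 0" and \<phi>: "\<phi> \<in> {a..b}"
  shows "\<phi> * torus_avg (f \<phi>) \<le> - \<gamma> * \<phi>\<^sup>2"
proof -
  have "torus_avg (\<lambda>\<psi>. \<phi> * f \<phi> \<psi>) \<le> torus_avg (\<lambda>\<psi>. \<phi> * f 0 \<psi> + - \<gamma> * \<phi>\<^sup>2)"
  proof (rule torus_avg_mono)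
    fix \<psi>
    obtain z where z: "min \<phi> 0 \<le> z" "z \<le> max \<phi> 0" "f \<phi> \<psi> - f 0 \<psi> = (\<phi> - 0) * f' z \<psi>"
      by (rule f_mvt)
    have "f' z \<psi> \<le> - \<gamma>" using z(1,2) \<phi> ab by (intro f'_neg) auto
    then have "\<phi>\<^sup>2 * f' z \<psi> \<le> \<phi>\<^sup>2 * - \<gamma>" by (intro mult_left_mono) auto
    moreover have "\<phi> * f \<phi> \<psi> = \<phi> * f 0 \<psi> + \<phi> * (f \<phi> \<psi> - f 0 \<psi>)" by (simp add: algebra_simps)
    ultimately show "\<phi> * f \<phi> \<psi> \<le> \<phi> * f 0 \<psi> + - \<gamma> * \<phi>\<^sup>2" unfolding z(3) by (simp add: power2_eq_square mult_ac)
  qed (auto intro!: continuous_intros cont_f_slice)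
  also have "\<dots> = torus_avg (\<lambda>\<psi>. \<phi> * f 0 \<psi>) + - \<gamma> * \<phi>\<^sup>2"
    by (subst torus_avg_add) (auto intro!: continuous_intros cont_f_slice)
  finally show ?thesis by (simp add: torus_avg_cmult zero)
qed

text \<open>The mean value theorem together with the Lipschitz bound on f' gives a pointwise error
  of at most \<phi>^2, which survives averaging.\<close>

lemma avg_f_linearization:
  assumes zero: "torus_avg (f 0) = 0"
  shows "\<bar>torus_avg (f \<phi>) - torus_avg (f' 0) * \<phi>\<bar> \<le> \<phi>\<^sup>2"
proof -
  have c: "continuous_on UNIV (f' 0)" by (rule continuous_on_slice(1)[OF continuous_f'])
  have "torus_avg (\<lambda>\<psi>. (f \<phi> \<psi> - f 0 \<psi>) - \<phi> * f' 0 \<psi>) = torus_avg (f \<phi>) - torus_avg (f' 0) * \<phi>"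
    using zero c by (simp add: torus_avg_diff torus_avg_cmult cont_f_slice continuous_intros)
  moreover have "\<bar>torus_avg (\<lambda>\<psi>. (f \<phi> \<psi> - f 0 \<psi>) - \<phi> * f' 0 \<psi>)\<bar> \<le> \<phi>\<^sup>2"
  proof (rule torus_avg_abs_le)
    show "continuous_on UNIV (\<lambda>\<psi>. (f \<phi> \<psi> - f 0 \<psi>) - \<phi> * f' 0 \<psi>)"
      by (intro continuous_intros cont_f_slice c)
    fix \<psi>
    obtain z where z: "min \<phi> 0 \<le> z" "z \<le> max \<phi> 0" "f \<phi> \<psi> - f 0 \<psi> = (\<phi> - 0) * f' z \<psi>"
      by (rule f_mvt)
    have "\<bar>f' z \<psi> - f' 0 \<psi>\<bar> \<le> \<bar>\<phi>\<bar>" using f'_lip[of z \<psi> 0] z(1,2) by linarith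
    then have "\<bar>\<phi>\<bar> * \<bar>f' z \<psi> - f' 0 \<psi>\<bar> \<le> \<bar>\<phi>\<bar> * \<bar>\<phi>\<bar>" by (intro mult_left_mono) auto
    then show "\<bar>(f \<phi> \<psi> - f 0 \<psi>) - \<phi> * f' 0 \<psi>\<bar> \<le> \<phi>\<^sup>2"
      unfolding z(3) by (simp add: power2_eq_square abs_mult flip: right_diff_distrib)
  qed
  ultimately show ?thesis by simp
qed

lemma invariant_function_moments:
  assumes zero: "torus_avg (f 0) = 0"
  obtains C where "\<And>\<rho> W. 0 < \<rho> \<Longrightarrow> \<rho> < 1 \<Longrightarrow> invariant_function \<rho> W \<Longrightarrow>
    \<bar>torus_avg W\<bar> \<le> C * \<rho> \<and> torus_avg (\<lambda>\<psi>. (W \<psi>)\<^sup>2) \<le> C * \<rho>"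
proof -
  obtain E where E: "0 \<le> E"
    "\<And>\<rho> W K g. 0 < \<rho> \<Longrightarrow> \<rho> < 1 \<Longrightarrow> invariant_function \<rho> W \<Longrightarrow> observable K g \<Longrightarrow>
       \<bar>torus_avg (\<lambda>\<psi>. g (W \<psi>) \<psi>)\<bar> \<le> \<rho> * (K * E)"
    by (rule averaging_along_graph) blast
  define E1 E2 where "E1 = (2 + H) * E" and "E2 = (b - a + 1) * (2 + H) * E"
  \<comment> \<open>E1 and E2 bound the averaged fluctuations. The 1 / 2 is the loss from <W f>
    \<ge> -\<rho> / 2; C2 reappears in C1 because <W^2> bounds the linearization error. Each
    division by \<gamma> inverts a slope of at most -\<gamma>.\<close>
  define C2 where "C2 = (E2 + 1 / 2) / \<gamma>"
  define C1 where "C1 = (E1 + C2) / \<gamma>"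
  show thesis
  proof
    fix \<rho> W assume \<rho>: "0 < \<rho>" "\<rho> < 1" and W: "invariant_function \<rho> W"
    have inv: "W (A *v \<psi>) = W \<psi> + \<rho> * f (W \<psi>) \<psi>" and range: "W \<psi> \<in> {a..b}"
      and perW: "periodic_T2 W" for \<psi>
      using W unfolding invariant_function_def by blast+
    have cW: "continuous_on UNIV W" by (rule invariant_function_continuous[OF \<rho> W])
    have cfW: "continuous_on UNIV (\<lambda>\<psi>. f (W \<psi>) \<psi>)" by (intro continuous_intros cW)
    have cfb: "continuous_on UNIV (\<lambda>\<psi>. torus_avg (f (W \<psi>)))"
      by (rule continuous_on_compose2[OF continuous_avg_f cW]) simp
    have cfl: "continuous_on UNIV (\<lambda>\<psi>. fluct (W \<psi>) \<psi>)"
      by (intro continuous_on_compose_curried[OF continuous_fluct] cW continuous_intros)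
    have e1: "\<bar>torus_avg (\<lambda>\<psi>. fluct (W \<psi>) \<psi>)\<bar> \<le> \<rho> * E1"
      unfolding E1_def by (rule E(2)[OF \<rho> W observable_fluct])
    have e2: "\<bar>torus_avg (\<lambda>\<psi>. W \<psi> * fluct (W \<psi>) \<psi>)\<bar> \<le> \<rho> * E2"
      unfolding E2_def by (rule E(2)[OF \<rho> W observable_mult_fluct])
    \<comment> \<open>\<rho> * f along the graph is the coboundary of W, so its mean
      vanishes.\<close>
    have mean_f: "torus_avg (\<lambda>\<psi>. f (W \<psi>) \<psi>) = 0"
    proof -
      have "torus_avg W = torus_avg (\<lambda>\<psi>. W \<psi> + \<rho> * f (W \<psi>) \<psi>)"
        using torus_avg_A[OF cW perW] by (simp add: inv)
      also have "\<dots> = torus_avg W + \<rho> * torus_avg (\<lambda>\<psi>. f (W \<psi>) \<psi>)"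
        using cW cfW by (subst torus_avg_add) (auto simp: torus_avg_cmult intro!: continuous_intros)
      finally show ?thesis using \<rho> by simp
    qed
    have mean_Wf: "- (\<rho> / 2) \<le> torus_avg (\<lambda>\<psi>. W \<psi> * f (W \<psi>) \<psi>)"
    proof -
      have "torus_avg (\<lambda>\<psi>. (W \<psi>)\<^sup>2) = torus_avg (\<lambda>\<psi>. (W (A *v \<psi>))\<^sup>2)"
        by (rule torus_avg_A[symmetric]) (use perW in \<open>auto intro!: continuous_intros cW simp: periodic_T2_def\<close>)
      also have "\<dots> \<le> torus_avg (\<lambda>\<psi>. (W \<psi>)\<^sup>2 + ((2 * \<rho>) * (W \<psi> * f (W \<psi>) \<psi>) + \<rho>\<^sup>2))"
      proof (rule torus_avg_mono)
        show "continuous_on UNIV (\<lambda>\<psi>. (W (A *v \<psi>))\<^sup>2)"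
          by (intro continuous_intros continuous_on_compose2[OF cW]) auto
        fix \<psi>
        have "(f (W \<psi>) \<psi>)\<^sup>2 \<le> 1" using f_le[of "W \<psi>" \<psi>] by (simp add: abs_square_le_1)
        then have "\<rho>\<^sup>2 * (f (W \<psi>) \<psi>)\<^sup>2 \<le> \<rho>\<^sup>2 * 1" by (intro mult_left_mono) auto
        then show "(W (A *v \<psi>))\<^sup>2 \<le> (W \<psi>)\<^sup>2 + ((2 * \<rho>) * (W \<psi> * f (W \<psi>) \<psi>) + \<rho>\<^sup>2)"
          by (simp add: inv power2_eq_square algebra_simps)
      qed (intro continuous_intros cW)
      also have "\<dots> = torus_avg (\<lambda>\<psi>. (W \<psi>)\<^sup>2) + (torus_avg (\<lambda>\<psi>. (2 * \<rho>) * (W \<psi> * f (W \<psi>) \<psi>)) + torus_avg (\<lambda>\<psi>. \<rho>\<^sup>2))"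
        using cW cfW by (simp only: torus_avg_add continuous_intros)
      finally have "0 \<le> (2 * \<rho>) * torus_avg (\<lambda>\<psi>. W \<psi> * f (W \<psi>) \<psi>) + \<rho>\<^sup>2"
        by (simp only: torus_avg_cmult torus_avg_const)
      then have "0 \<le> \<rho> * (2 * torus_avg (\<lambda>\<psi>. W \<psi> * f (W \<psi>) \<psi>) + \<rho>)"
        by (simp add: power2_eq_square algebra_simps)
      then show ?thesis using \<rho> by (simp add: zero_le_mult_iff)
    qed
    have "torus_avg (\<lambda>\<psi>. W \<psi> * f (W \<psi>) \<psi>)
        \<le> torus_avg (\<lambda>\<psi>. - \<gamma> * (W \<psi>)\<^sup>2 + W \<psi> * fluct (W \<psi>) \<psi>)"
    proof (rule torus_avg_mono)
      fix \<psi>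
      show "W \<psi> * f (W \<psi>) \<psi> \<le> - \<gamma> * (W \<psi>)\<^sup>2 + W \<psi> * fluct (W \<psi>) \<psi>"
        using avg_f_dissipative[OF zero range[of \<psi>]] by (simp add: fluct_def algebra_simps)
    qed (intro continuous_intros cW cfl)+
    also have "\<dots> = - \<gamma> * torus_avg (\<lambda>\<psi>. (W \<psi>)\<^sup>2) + torus_avg (\<lambda>\<psi>. W \<psi> * fluct (W \<psi>) \<psi>)"
      unfolding torus_avg_cmult[symmetric] by (intro torus_avg_add continuous_intros cW cfl)
    finally have "\<gamma> * torus_avg (\<lambda>\<psi>. (W \<psi>)\<^sup>2) \<le> \<rho> * (E2 + 1 / 2)"
      using mean_Wf e2 by (simp add: algebra_simps)
    then have w2: "torus_avg (\<lambda>\<psi>. (W \<psi>)\<^sup>2) \<le> C2 * \<rho>"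
      using \<gamma>_pos by (simp add: C2_def field_simps)
    \<comment> \<open>Since f has mean zero along the graph, the averaged field evaluated at W has
      the mean of the fluctuation up to sign, hence a mean of size O(\<rho>).\<close>
    have "torus_avg (\<lambda>\<psi>. fluct (W \<psi>) \<psi>) = - torus_avg (\<lambda>\<psi>. torus_avg (f (W \<psi>)))"
      unfolding fluct_def using mean_f by (subst torus_avg_diff[OF cfW cfb]) simp
    then have fb: "\<bar>torus_avg (\<lambda>\<psi>. torus_avg (f (W \<psi>)))\<bar> \<le> \<rho> * E1" using e1 by simp
    let ?d = "torus_avg (f' 0)"
    have "\<bar>torus_avg (\<lambda>\<psi>. torus_avg (f (W \<psi>)) - ?d * W \<psi>)\<bar> \<le> torus_avg (\<lambda>\<psi>. (W \<psi>)\<^sup>2)"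
    proof -
      have c: "continuous_on UNIV (\<lambda>\<psi>. torus_avg (f (W \<psi>)) - ?d * W \<psi>)"
        by (intro continuous_intros cW cfb)
      have "torus_avg (f (W x)) - ?d * W x \<le> (W x)\<^sup>2" "(-1) * (W x)\<^sup>2 \<le> torus_avg (f (W x)) - ?d * W x" for x
        using avg_f_linearization[OF zero, of "W x"] unfolding abs_le_iff by linarith+
      then have "torus_avg (\<lambda>\<psi>. torus_avg (f (W \<psi>)) - ?d * W \<psi>) \<le> torus_avg (\<lambda>\<psi>. (W \<psi>)\<^sup>2)"
        "torus_avg (\<lambda>\<psi>. (-1) * (W \<psi>)\<^sup>2) \<le> torus_avg (\<lambda>\<psi>. torus_avg (f (W \<psi>)) - ?d * W \<psi>)"
        by (auto intro!: torus_avg_mono c continuous_intros cW simp del: mult_minus1)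
      then show ?thesis unfolding torus_avg_cmult by linarith
    qed
    moreover have "torus_avg (\<lambda>\<psi>. torus_avg (f (W \<psi>)) - ?d * W \<psi>)
        = torus_avg (\<lambda>\<psi>. torus_avg (f (W \<psi>))) - ?d * torus_avg W"
      unfolding torus_avg_cmult[symmetric] by (intro torus_avg_diff continuous_intros cW cfb)
    ultimately have dW: "\<bar>?d * torus_avg W\<bar> \<le> \<rho> * E1 + C2 * \<rho>" using fb w2 by linarith
    have "?d \<le> - \<gamma>"
    proof -
      have "?d \<le> torus_avg (\<lambda>_. - \<gamma>)"
        by (rule torus_avg_mono) (use f'_neg[OF ab] continuous_on_slice(1)[OF continuous_f'] in auto)
      then show ?thesis by simp
    qed
    then have "\<gamma> * \<bar>torus_avg W\<bar> \<le> \<bar>?d\<bar> * \<bar>torus_avg W\<bar>" by (intro mult_right_mono) auto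
    also have "\<dots> \<le> \<rho> * E1 + C2 * \<rho>" using dW by (simp add: abs_mult)
    finally have "\<bar>torus_avg W\<bar> \<le> C1 * \<rho>" using \<gamma>_pos by (simp add: C1_def field_simps)
    moreover have "C1 * \<rho> \<le> max C1 C2 * \<rho>" "C2 * \<rho> \<le> max C1 C2 * \<rho>"
      using \<rho> by (auto intro!: mult_right_mono)
    ultimately show "\<bar>torus_avg W\<bar> \<le> max C1 C2 * \<rho> \<and> torus_avg (\<lambda>\<psi>. (W \<psi>)\<^sup>2) \<le> max C1 C2 * \<rho>"
      using w2 by linarith
  qed
qed

end

section \<open>The norm of \<open>\<B>\<^bsub>\<alpha>,k\<^esub>\<close>\<close>

lemma dphi_bounded:
  assumes "B_norm \<alpha> k g \<le> 1" "n \<le> k"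
  shows "\<bar>dphi n g \<phi> \<psi>\<bar> \<le> 1"
proof -
  have "ennreal \<bar>dphi n g \<phi> \<psi>\<bar> \<le> sup_norm (dphi n g)"
    unfolding sup_norm_def by (rule SUP_upper2[of "(\<phi>, \<psi>)"]) auto
  also have "\<dots> \<le> (\<Sum>n\<le>k. sup_norm (dphi n g))"
    using assms by (intro member_le_sum) auto
  also have "\<dots> \<le> B_norm \<alpha> k g" unfolding B_norm_def by (rule add_increasing2) auto
  also have "\<dots> \<le> 1" by (rule assms)
  finally show ?thesis by simp
qed

text \<open>The factor 1 / \<alpha> undoes the weight \<alpha> in front of the Hoelder seminorms in
  the norm.\<close>

lemma dphi_holder:
  assumes "B_norm \<alpha> k g \<le> 1" "n < k" and \<alpha>: "0 < \<alpha>"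
  shows "\<bar>dphi n g \<phi> \<psi>' - dphi n g \<phi> \<psi>\<bar> \<le> 1 / \<alpha> * norm (\<psi>' - \<psi>) powr \<alpha>"
proof -
  let ?q = "\<bar>dphi n g \<phi> \<psi>' - dphi n g \<phi> \<psi>\<bar> / norm (\<psi>' - \<psi>) powr \<alpha>"
  have "ennreal ?q \<le> holder_seminorm \<alpha> (dphi n g)"
    unfolding holder_seminorm_def by (rule SUP_upper2[of "(\<phi>, \<psi>, \<psi>')"]) auto
  also have "\<dots> \<le> (\<Sum>n<k. holder_seminorm \<alpha> (dphi n g))"
    using assms by (intro member_le_sum) auto
  finally have "ennreal \<alpha> * ennreal ?q \<le> ennreal \<alpha> * (\<Sum>n<k. holder_seminorm \<alpha> (dphi n g))"
    by (rule mult_left_mono) simp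
  also have "\<dots> \<le> B_norm \<alpha> k g" unfolding B_norm_def by (rule add_increasing) auto
  also have "\<dots> \<le> 1" by (rule assms)
  finally have "ennreal \<alpha> * ennreal ?q \<le> 1" .
  moreover have "ennreal (\<alpha> * ?q) = ennreal \<alpha> * ennreal ?q"
    by (rule ennreal_mult) (use \<alpha> in auto)
  ultimately have "ennreal (\<alpha> * ?q) \<le> 1" by (simp only:)
  then have "\<alpha> * ?q \<le> 1" by simp
  then show ?thesis using \<alpha> by (cases "\<psi>' = \<psi>") (auto simp: field_simps)
qed

lemma dphi_has_derivative:
  assumes "g \<in> B_space \<alpha> k" "n < k"
  shows "((\<lambda>x. dphi n g x \<psi>) has_real_derivative dphi (Suc n) g \<phi> \<psi>) (at \<phi>)"
proof -
  have "(\<lambda>x. dphi n g x \<psi>) differentiable (at \<phi>)"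
    using assms by (simp add: B_space_def)
  then have "((\<lambda>x. dphi n g x \<psi>) has_real_derivative deriv (\<lambda>x. dphi n g x \<psi>) \<phi>) (at \<phi>)"
    by (simp add: DERIV_deriv_iff_real_differentiable)
  then show ?thesis by (simp add: dphi_def)
qed

theorem theorem4:
  fixes A\<^sub>0 :: "real^2^2" and f :: "real \<Rightarrow> real^2 \<Rightarrow> real"
    and \<alpha>\<^sub>0 \<phi>\<^sub>m \<phi>\<^sub>M S\<^sub>m S\<^sub>M :: real and S :: "real^2 \<Rightarrow> real" and \<Lambda> :: "(real \<times> (real^2)) set"
  assumes "anosov_automorphism A\<^sub>0"
    and "0 < \<alpha>\<^sub>0" "\<alpha>\<^sub>0 \<le> 1"
    and "f \<in> B_space \<alpha>\<^sub>0 6" "B_norm \<alpha>\<^sub>0 6 f = 1"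
    and "\<phi>\<^sub>m < \<phi>\<^sub>M" "\<phi>\<^sub>M - \<phi>\<^sub>m < 2 * pi"
    and "\<And>\<psi>. f \<phi>\<^sub>m \<psi> > 0" "\<And>\<psi>. 0 > f \<phi>\<^sub>M \<psi>"
    and "\<And>\<psi>. S \<psi> \<in> {\<phi>\<^sub>m<..<\<phi>\<^sub>M}" "\<And>\<psi>. f (S \<psi>) \<psi> = 0"
    and "\<And>\<psi> s. s \<in> {\<phi>\<^sub>m<..<\<phi>\<^sub>M} \<Longrightarrow> f s \<psi> = 0 \<Longrightarrow> s = S \<psi>"
    and "S\<^sub>m = (INF \<psi>. S \<psi>)" "S\<^sub>M = (SUP \<psi>. S \<psi>)" "\<Lambda> = {S\<^sub>m..S\<^sub>M} \<times> UNIV"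
    and "- (SUP (\<phi>, \<psi>)\<in>\<Lambda>. dphi 1 f \<phi> \<psi>) > 0"
    and "0 \<in> {S\<^sub>m..S\<^sub>M}" "torus_avg (f 0) = 0"
    and "\<And>\<phi>. \<phi> \<in> {\<phi>\<^sub>m..\<phi>\<^sub>M} \<Longrightarrow> torus_avg (f \<phi>) = 0 \<Longrightarrow> \<phi> = 0"
  shows "\<exists>\<rho>s>0. \<exists>C\<^sub>5. \<forall>\<rho>\<in>{0<..<\<rho>s}.
           (\<exists>!W. invariant_graph f A\<^sub>0 \<rho> \<Lambda> W) \<and>
           (\<forall>W. invariant_graph f A\<^sub>0 \<rho> \<Lambda> W \<longrightarrow>
              \<bar>torus_avg W\<bar> \<le> C\<^sub>5 * \<rho> \<and> torus_avg (\<lambda>\<psi>. (W \<psi>)\<^sup>2) \<le> C\<^sub>5 * \<rho>)"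
proof -
  obtain B \<nu> \<mu> eu es c1 c2 \<kappa> where "hyperbolic_toral A\<^sub>0 B \<nu> \<mu> eu es c1 c2 \<kappa>"
    using hyperbolic_toral_ex[OF assms(1)] by blast
  then interpret hyperbolic_toral A\<^sub>0 B \<nu> \<mu> eu es c1 c2 \<kappa> .
  define \<gamma> where "\<gamma> = - (SUP (\<phi>, \<psi>)\<in>\<Lambda>. dphi 1 f \<phi> \<psi>)"
  have norm: "B_norm \<alpha>\<^sub>0 6 f \<le> 1" using assms(5) by simp
  have dphi0: "dphi 0 f = f" by (simp add: dphi_def fun_eq_iff)
  have S: "S\<^sub>m \<le> S \<psi>" "S \<psi> \<le> S\<^sub>M" for \<psi>
  proof -
    have "\<phi>\<^sub>m \<le> S \<psi>" "S \<psi> \<le> \<phi>\<^sub>M" for \<psi> using assms(10)[of \<psi>] by auto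
    then have "bdd_below (range S)" "bdd_above (range S)" by (auto intro!: bdd_belowI[of _ \<phi>\<^sub>m] bdd_aboveI[of _ \<phi>\<^sub>M])
    then show "S\<^sub>m \<le> S \<psi>" "S \<psi> \<le> S\<^sub>M" unfolding assms(13,14)
      by (auto intro: cINF_lower cSUP_upper)
  qed
  have deriv: "((\<lambda>x. f x \<psi>) has_real_derivative dphi 1 f \<phi> \<psi>) (at \<phi>)" for \<phi> \<psi>
    using dphi_has_derivative[OF assms(4), of 0 \<psi> \<phi>] by (simp add: dphi0)
  have neg: "dphi 1 f \<phi> \<psi> \<le> - \<gamma>" if "\<phi> \<in> {S\<^sub>m..S\<^sub>M}" for \<phi> \<psi>
  proof -
    \<comment> \<open>A real supremum bounds its members only over a set bounded above; the
      normalization of f supplies the bound.\<close>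
    have "dphi 1 f x y \<le> 1" for x y using dphi_bounded[OF norm, of 1 x y] by simp
    then have "bdd_above ((\<lambda>(\<phi>, \<psi>). dphi 1 f \<phi> \<psi>) ` \<Lambda>)"
      by (intro bdd_aboveI[of _ 1]) auto
    moreover have "(\<phi>, \<psi>) \<in> \<Lambda>" using that by (simp add: assms(15))
    ultimately have "(\<lambda>(\<phi>, \<psi>). dphi 1 f \<phi> \<psi>) (\<phi>, \<psi>) \<le> - \<gamma>"
      unfolding \<gamma>_def minus_minus by (intro cSUP_upper)
    then show ?thesis by simp
  qed
  \<comment> \<open>Monotonicity on the strip turns f (S \<psi>) \<psi> = 0 into the signs of f at
    the two ends, for all \<psi> at once.\<close>
  have antimono: "f y \<psi> \<le> f x \<psi>" if "S\<^sub>m \<le> x" "x \<le> y" "y \<le> S\<^sub>M" for x y \<psi>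
  proof (rule DERIV_nonpos_imp_nonincreasing[OF that(2)])
    fix z assume "x \<le> z" "z \<le> y"
    then have "dphi 1 f z \<psi> \<le> 0" using neg[of z \<psi>] that assms(16) by (simp add: \<gamma>_def)
    then show "\<exists>d. ((\<lambda>x. f x \<psi>) has_real_derivative d) (at z) \<and> d \<le> 0" using deriv by blast
  qed
  interpret forced_skew_product A\<^sub>0 B \<nu> \<mu> eu es c1 c2 \<kappa> f "dphi 1 f" \<alpha>\<^sub>0 "1 / \<alpha>\<^sub>0" S\<^sub>m S\<^sub>M \<gamma>
  proof
    show "0 < \<alpha>\<^sub>0" "\<alpha>\<^sub>0 \<le> 1" "0 \<le> 1 / \<alpha>\<^sub>0" using assms(2,3) by auto
    show "0 \<in> {S\<^sub>m..S\<^sub>M}" by (rule assms(17))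
    show "0 < \<gamma>" using assms(16) by (simp add: \<gamma>_def)
    fix \<phi> x y :: real and \<psi> \<psi>' :: "real^2"
    show "periodic_T2 (f \<phi>)" using assms(4) by (simp add: B_space_def)
    show "((\<lambda>x. f x \<psi>) has_real_derivative dphi 1 f \<phi> \<psi>) (at \<phi>)" by (rule deriv)
    show "\<bar>f \<phi> \<psi>\<bar> \<le> 1" using dphi_bounded[OF norm, of 0 \<phi> \<psi>] by (simp add: dphi0)
    show "\<bar>dphi 1 f \<phi> \<psi>\<bar> \<le> 1" using dphi_bounded[OF norm, of 1 \<phi> \<psi>] by simp
    have "norm (dphi 1 f x \<psi> - dphi 1 f y \<psi>) \<le> 1 * norm (x - y)"
    proof (rule field_differentiable_bound[of UNIV _ "\<lambda>x. dphi (Suc 1) f x \<psi>"])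
      show "((\<lambda>x. dphi 1 f x \<psi>) has_real_derivative dphi (Suc 1) f z \<psi>) (at z within UNIV)" for z
        using dphi_has_derivative[OF assms(4), of 1] by simp
      show "norm (dphi (Suc 1) f z \<psi>) \<le> 1" for z
        using dphi_bounded[OF norm, of "Suc 1" z \<psi>] by simp
    qed auto
    then show "\<bar>dphi 1 f x \<psi> - dphi 1 f y \<psi>\<bar> \<le> \<bar>x - y\<bar>" by simp
    show "\<bar>f \<phi> \<psi>' - f \<phi> \<psi>\<bar> \<le> 1 / \<alpha>\<^sub>0 * norm (\<psi>' - \<psi>) powr \<alpha>\<^sub>0"
      using dphi_holder[OF norm _ assms(2), of 0 \<phi> \<psi>' \<psi>] by (simp add: dphi0)
    show "\<bar>dphi 1 f \<phi> \<psi>' - dphi 1 f \<phi> \<psi>\<bar> \<le> 1 / \<alpha>\<^sub>0 * norm (\<psi>' - \<psi>) powr \<alpha>\<^sub>0"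
      using dphi_holder[OF norm _ assms(2), of 1 \<phi> \<psi>' \<psi>] by simp
    show "dphi 1 f \<phi> \<psi> \<le> - \<gamma>" if "\<phi> \<in> {S\<^sub>m..S\<^sub>M}" using that by (rule neg)
    show "0 \<le> f S\<^sub>m \<psi>" using antimono[of S\<^sub>m "S \<psi>" \<psi>] S[of \<psi>] assms(11) by simp
    show "f S\<^sub>M \<psi> \<le> 0" using antimono[of "S \<psi>" S\<^sub>M \<psi>] S[of \<psi>] assms(11) by simp
  qed
  have graph: "invariant_graph f A\<^sub>0 \<rho> \<Lambda> W \<longleftrightarrow> invariant_function \<rho> W" for \<rho> W
    by (auto simp: invariant_graph_def invariant_function_def skew_map_def assms(15))
  obtain C where C: "\<And>\<rho> W. 0 < \<rho> \<Longrightarrow> \<rho> < 1 \<Longrightarrow> invariant_function \<rho> W \<Longrightarrow>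
    \<bar>torus_avg W\<bar> \<le> C * \<rho> \<and> torus_avg (\<lambda>\<psi>. (W \<psi>)\<^sup>2) \<le> C * \<rho>"
    by (rule invariant_function_moments[OF assms(18)]) blast
  show ?thesis
    unfolding graph
  \<comment> \<open>The threshold 1 suffices: the norm of f bounds its \<phi>-derivative by 1, so
    the fibre maps are increasing for every \<rho> < 1.\<close>
  proof (rule exI[of _ 1], rule conjI[OF zero_less_one], rule exI[of _ C], intro ballI conjI)
    fix \<rho> :: real assume "\<rho> \<in> {0<..<1}"
    then have \<rho>: "0 < \<rho>" "\<rho> < 1" by auto
    show "\<exists>!W. invariant_function \<rho> W" by (rule ex1_invariant_function[OF \<rho>])
    show "\<forall>W. invariant_function \<rho> W \<longrightarrow> \<bar>torus_avg W\<bar> \<le> C * \<rho> \<and> torus_avg (\<lambda>\<psi>. (W \<psi>)\<^sup>2) \<le> C * \<rho>"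
      using C[OF \<rho>] by blast
  qed
qed

end
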